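(* Let $\mathcal A$ be a $C^*$-algebra, and let $\Gamma:\ell^2(\mathcal A)\to\mathcal A$ be an $\mathcal A$-functional with coefficients $\Gamma_i\in RM(\mathcal A)$, $i\in\mathbb N$, i.e. $\Gamma(x)=\sum_{i=1}^\infty \Gamma_i^*x_i$ for $x=(x_1,x_2,\dots)\in\ell^2(\mathcal A)$. Then $\Gamma$ is locally adjointable if and only if its collection of coefficients $\{\Gamma_i\}$ determines an element of the dual module $(M(\ell^2(\mathcal A)))'$.
   Context: All modules are right Hilbert $C^*$-modules, with inner products conjugate-linear in the first variable and satisfying $\langle x,ya\rangle=\langle x,y\rangle a$. An operator between Hilbert $\mathcal A$-modules is a bounded $\mathcal A$-homomorphism; $F:\mathcal M\to\mathcal N$ is adjointable if there is $F^*:\mathcal N\to\mathcal M$ with $\langle Fx,y\rangle=\langle x,F^*y\rangle$ for all $x,y$. The algebra $\mathcal A$ is a Hilbert $\mathcal A$-module with $\langle a,b\rangle=a^*b$. A bounded $\mathcal A$-morphism $F:\mathcal M\to\mathcal N$ is locally adjointable if for every adjointable $\gamma:\mathcal A\to\mathcal M$ the composition $F\circ\gamma:\mathcal A\to\mathcal N$ is adjointable. An $\mathcal A$-functional on $\mathcal M$ is a bounded $\mathcal A$-homomorphism $\mathcal M\to\mathcal A$. $\ell^2(\mathcal A)$ is the module of sequences $a=(a_1,a_2,\dots)$ in $\mathcal A$ with $\sum_i a_i^*a_i$ norm-convergent, with $\langle a,b\rangle=\sum_i a_i^*b_i$. $\mathcal A$ is assumed faithfully and non-degenerately represented on a Hilbert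 space $H$; $LM(\mathcal A)=\{T\in B(H): Ta\in\mathcal A\ \forall a\in \mathcal A\}$, $RM(\mathcal A)=\{T\in B(H): aT\in\mathcal A\ \forall a\in \mathcal A\}$ and $M(\mathcal A)=LM(\mathcal A)\cap RM(\mathcal A)$ are the left, right and two-sided multipliers. Left strict convergence $T_\lambda\to T$ means $\|T_\lambda a-Ta\|\to0$ for every $a\in\mathcal A$. Known fact (Bakić): every $\mathcal A$-functional $\Gamma$ on $\ell^2(\mathcal A)$ is given by a unique sequence of coefficients $\Gamma_i\in RM(\mathcal A)$ such that $\sum_i\Gamma_i^*\Gamma_i$ converges strongly in $B(H)$, acting by $\Gamma(x)=\sum_i\Gamma_i^*x_i$ (norm-convergent); conversely every such sequence defines an $\mathcal A$-functional. $M(\ell^2(\mathcal A))$ (the multiplier module) is the Hilbert $M(\mathcal A)$-module of all adjointable maps $r:\mathcal A\to\ell^2(\mathcal A)$, with inner product $\langle r_1,r_2\rangle=r_1^*r_2\in M(\mathcal A)$. It is identified with the set of sequences $\beta=\{\beta_i\}$ in $M(\mathcal A)$ such that $\sum_i\beta_i^*\beta_i$ is strictly convergent, $\beta$ corresponding to the map $a\mapsto(\beta_1a,\beta_2a,\dots)$. Its dual module $(M(\ell^2(\mathcal A)))'$ is the set of bounded $M(\mathcal A)$-homomorphisms $M(\ell^2(\mathcal A))\to M(\mathcal A)$. A sequence $\{\alpha_i\}$ determines an element of $(M(\ell^2(\mathcal A)))'$ if all $\alpha_i\in M(\mathcal A)$ and: 1) the partial sums of $\sum_i\alpha_i^*\alpha_i$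 are bounded, i.e. this series converges strongly in $B(H)$; 2) for any $\beta=\{\beta_i\}\in M(\ell^2(\mathcal A))$ the series $\sum_i\alpha_i^*\beta_i$ is left strictly convergent; 3) its limit (a priori in $LM(\mathcal A)$) belongs to $M(\mathcal A)$. The element determined is then $\beta\mapsto\sum_i\alpha_i^*\beta_i$. *)

theory Defs
  imports "HOL-Analysis.Analysis"
begin

section \<open>Complex Hilbert spaces and their bounded operators\<close>

text \<open>
  The underlying real structure is that of the library, so that the norm, completeness and the
  type of bounded operators can be taken from there; the complex structure is added on top.
  Inner products are conjugate-linear in the first variable. The space may be trivial.
\<close>

class complex_hilbert_space = real_inner + complete_space +
  fixes scaleC :: "complex \<Rightarrow> 'a \<Rightarrow> 'a" (infixr "*\<^sub>C" 75)
    and cinner :: "'a \<Rightarrow> 'a \<Rightarrow> complex"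
  assumes scaleC_add_right: "c *\<^sub>C (x + y) = c *\<^sub>C x + c *\<^sub>C y"
    and scaleC_add_left: "(c + d) *\<^sub>C x = c *\<^sub>C x + d *\<^sub>C x"
    and scaleC_scaleC: "c *\<^sub>C (d *\<^sub>C x) = (c * d) *\<^sub>C x"
    and scaleC_of_real: "complex_of_real r *\<^sub>C x = r *\<^sub>R x"
    and cinner_commute: "cinner x y = cnj (cinner y x)"
    and cinner_add_right: "cinner x (y + z) = cinner x y + cinner x z"
    and cinner_scaleC_right: "cinner x (c *\<^sub>C y) = c * cinner x y"
    and Re_cinner: "Re (cinner x y) = inner x y"

instantiation complex :: complex_hilbert_space
begin

definition scaleC_complex :: "complex \<Rightarrow> complex \<Rightarrow> complex"
  where "scaleC_complex c x = c * x"

definition cinner_complex :: "complex \<Rightarrow> complex \<Rightarrow> complex"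
  where "cinner_complex x y = cnj x * y"

instance
  by standard
    (auto simp: scaleC_complex_def cinner_complex_def inner_complex_def scaleR_conv_of_real
      algebra_simps)

end

text \<open>
  Elements of the type \<open>'h \<Rightarrow>\<^sub>L 'h\<close> are only real-linear; \<open>BH\<close> is the set of the complex-linear
  ones. The operator norm does not depend on the choice of the scalar field.
\<close>

type_synonym 'h bop = "'h \<Rightarrow>\<^sub>L 'h"

definition BH :: "'h::complex_hilbert_space bop set"
  where "BH = {T. \<forall>c x. blinfun_apply T (c *\<^sub>C x) = c *\<^sub>C blinfun_apply T x}"

definition op_scaleC :: "complex \<Rightarrow> 'h::complex_hilbert_space bop \<Rightarrow> 'h bop"
  where "op_scaleC c T = Blinfun (\<lambda>x. c *\<^sub>C blinfun_apply T x)"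

text \<open>Every \<open>T \<in> BH\<close> has exactly one adjoint; outside \<open>BH\<close> the value is irrelevant.\<close>

definition adj :: "'h::complex_hilbert_space bop \<Rightarrow> 'h bop"
  where "adj T = (THE S. \<forall>x y. cinner (blinfun_apply T x) y = cinner x (blinfun_apply S y))"


section \<open>Represented \<open>C\<^sup>*\<close>-algebras and multipliers\<close>

text \<open>
  A \<open>C\<^sup>*\<close>-algebra with a faithful representation on \<open>H\<close> is identified with its image, a norm-closed
  \<open>*\<close>-subalgebra of \<open>BH\<close>; no unit is assumed. Since \<open>A\<close> is closed under complex scalars, the real
  span in the non-degeneracy condition is also the complex one.
\<close>

locale nondegenerate_cstar_algebra =
  fixes A :: "'h::complex_hilbert_space bop set"
  assumes subset_BH: "A \<subseteq> BH"
    and zero_mem: "0 \<in> A"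
    and add_mem: "a \<in> A \<Longrightarrow> b \<in> A \<Longrightarrow> a + b \<in> A"
    and scale_mem: "a \<in> A \<Longrightarrow> op_scaleC c a \<in> A"
    and mult_mem: "a \<in> A \<Longrightarrow> b \<in> A \<Longrightarrow> a o\<^sub>L b \<in> A"
    and adj_mem: "a \<in> A \<Longrightarrow> adj a \<in> A"
    and closed: "closed A"
    and nondegenerate: "closure (span {blinfun_apply a \<xi> | a \<xi>. a \<in> A}) = UNIV"

definition LM :: "'h::complex_hilbert_space bop set \<Rightarrow> 'h bop set"
  where "LM A = {T \<in> BH. \<forall>a\<in>A. T o\<^sub>L a \<in> A}"

definition RM :: "'h::complex_hilbert_space bop set \<Rightarrow> 'h bop set"
  where "RM A = {T \<in> BH. \<forall>a\<in>A. a o\<^sub>L T \<in> A}"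

definition MM :: "'h::complex_hilbert_space bop set \<Rightarrow> 'h bop set"
  where "MM A = LM A \<inter> RM A"

definition left_strict_sums ::
    "'h::complex_hilbert_space bop set \<Rightarrow> (nat \<Rightarrow> 'h bop) \<Rightarrow> 'h bop \<Rightarrow> bool"
  where "left_strict_sums A t T \<longleftrightarrow> (\<forall>a\<in>A. (\<lambda>n. (\<Sum>i<n. t i) o\<^sub>L a) \<longlonglongrightarrow> (T o\<^sub>L a))"

definition right_strict_sums ::
    "'h::complex_hilbert_space bop set \<Rightarrow> (nat \<Rightarrow> 'h bop) \<Rightarrow> 'h bop \<Rightarrow> bool"
  where "right_strict_sums A t T \<longleftrightarrow> (\<forall>a\<in>A. (\<lambda>n. a o\<^sub>L (\<Sum>i<n. t i)) \<longlonglongrightarrow> (a o\<^sub>L T))"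


section \<open>Hilbert modules and their operators\<close>

text \<open>
  The operations of a right Hilbert module over a subalgebra of \<open>BH\<close>; they matter only on the
  carrier.
\<close>

record ('b, 'm) hilbert_module =
  mcarrier :: "'m set"
  madd :: "'m \<Rightarrow> 'm \<Rightarrow> 'm"
  mscale :: "complex \<Rightarrow> 'm \<Rightarrow> 'm"
  mact :: "'m \<Rightarrow> 'b \<Rightarrow> 'm"
  mip :: "'m \<Rightarrow> 'm \<Rightarrow> 'b"

definition mnorm :: "('h::complex_hilbert_space bop, 'm) hilbert_module \<Rightarrow> 'm \<Rightarrow> real"
  where "mnorm M x = sqrt (norm (mip M x x))"

definition bounded_module_hom ::
    "'h::complex_hilbert_space bop set \<Rightarrow> ('h bop, 'm) hilbert_module \<Rightarrow> ('h bop, 'n) hilbert_module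
      \<Rightarrow> ('m \<Rightarrow> 'n) \<Rightarrow> bool"
  where "bounded_module_hom A M N F \<longleftrightarrow>
    F \<in> mcarrier M \<rightarrow> mcarrier N \<and>
    (\<forall>x\<in>mcarrier M. \<forall>y\<in>mcarrier M. F (madd M x y) = madd N (F x) (F y)) \<and>
    (\<forall>c. \<forall>x\<in>mcarrier M. F (mscale M c x) = mscale N c (F x)) \<and>
    (\<forall>x\<in>mcarrier M. \<forall>a\<in>A. F (mact M x a) = mact N (F x) a) \<and>
    (\<exists>K. \<forall>x\<in>mcarrier M. mnorm N (F x) \<le> K * mnorm M x)"

definition adjointable ::
    "'h::complex_hilbert_space bop set \<Rightarrow> ('h bop, 'm) hilbert_module \<Rightarrow> ('h bop, 'n) hilbert_module
      \<Rightarrow> ('m \<Rightarrow> 'n) \<Rightarrow> bool"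
  where "adjointable A M N F \<longleftrightarrow>
    bounded_module_hom A M N F \<and>
    (\<exists>F' \<in> mcarrier N \<rightarrow> mcarrier M.
      \<forall>x\<in>mcarrier M. \<forall>y\<in>mcarrier N. mip N (F x) y = mip M x (F' y))"

definition algebra_module ::
    "'h::complex_hilbert_space bop set \<Rightarrow> ('h bop, 'h bop) hilbert_module"
  where "algebra_module A =
    \<lparr>mcarrier = A, madd = (+), mscale = op_scaleC, mact = (o\<^sub>L), mip = (\<lambda>a b. adj a o\<^sub>L b)\<rparr>"

definition locally_adjointable ::
    "'h::complex_hilbert_space bop set \<Rightarrow> ('h bop, 'm) hilbert_module \<Rightarrow> ('h bop, 'n) hilbert_module
      \<Rightarrow> ('m \<Rightarrow> 'n) \<Rightarrow> bool"
  where "locally_adjointable A M N F \<longleftrightarrow>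
    bounded_module_hom A M N F \<and>
    (\<forall>\<gamma>. adjointable A (algebra_module A) M \<gamma> \<longrightarrow> adjointable A (algebra_module A) N (F \<circ> \<gamma>))"

definition module_functional ::
    "'h::complex_hilbert_space bop set \<Rightarrow> ('h bop, 'm) hilbert_module \<Rightarrow> ('m \<Rightarrow> 'h bop) \<Rightarrow> bool"
  where "module_functional A M F \<longleftrightarrow> bounded_module_hom A M (algebra_module A) F"

definition ell2 ::
    "'h::complex_hilbert_space bop set \<Rightarrow> ('h bop, nat \<Rightarrow> 'h bop) hilbert_module"
  where "ell2 A =
    \<lparr>mcarrier = {x. (\<forall>i. x i \<in> A) \<and> summable (\<lambda>i. adj (x i) o\<^sub>L x i)},
     madd = (\<lambda>x y i. x i + y i),
     mscale = (\<lambda>c x i. op_scaleC c (x i)),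
     mact = (\<lambda>x a i. x i o\<^sub>L a),
     mip = (\<lambda>x y. \<Sum>i. adj (x i) o\<^sub>L y i)\<rparr>"


section \<open>The multiplier module of \<open>\<ell>\<^sup>2(A)\<close> and elements of its dual\<close>

text \<open>
  The multiplier module of \<open>\<ell>\<^sup>2(A)\<close> consists of the adjointable maps from \<open>A\<close> to \<open>\<ell>\<^sup>2(A)\<close>. As usual,
  it is identified with a set of sequences of multipliers, \<open>\<beta>\<close> standing for the map that sends \<open>a\<close>
  to the sequence \<open>\<beta> i o\<^sub>L a\<close>.
\<close>

definition ell2_multipliers ::
    "'h::complex_hilbert_space bop set \<Rightarrow> (nat \<Rightarrow> 'h bop) set"
  where "ell2_multipliers A =
    {\<beta>. (\<forall>i. \<beta> i \<in> MM A) \<and>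
        (\<exists>T\<in>MM A. left_strict_sums A (\<lambda>i. adj (\<beta> i) o\<^sub>L \<beta> i) T \<and>
                  right_strict_sums A (\<lambda>i. adj (\<beta> i) o\<^sub>L \<beta> i) T)}"

text \<open>
  The sequence \<open>\<alpha>\<close> determines the functional that sends \<open>\<beta>\<close> to the left strict limit of the partial
  sums of \<open>adj (\<alpha> i) o\<^sub>L \<beta> i\<close>. The partial sums of \<open>adj (\<alpha> i) o\<^sub>L \<alpha> i\<close> form an increasing sequence of
  positive operators, so their boundedness amounts to strong convergence.
\<close>

definition determines_dual_element ::
    "'h::complex_hilbert_space bop set \<Rightarrow> (nat \<Rightarrow> 'h bop) \<Rightarrow> bool"
  where "determines_dual_element A \<alpha> \<longleftrightarrow>
    (\<forall>i. \<alpha> i \<in> MM A) \<and>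
    bounded (range (\<lambda>n. \<Sum>i<n. adj (\<alpha> i) o\<^sub>L \<alpha> i)) \<and>
    (\<forall>\<beta>\<in>ell2_multipliers A. \<exists>T\<in>LM A. left_strict_sums A (\<lambda>i. adj (\<alpha> i) o\<^sub>L \<beta> i) T) \<and>
    (\<forall>\<beta>\<in>ell2_multipliers A. \<forall>T\<in>LM A.
      left_strict_sums A (\<lambda>i. adj (\<alpha> i) o\<^sub>L \<beta> i) T \<longrightarrow> T \<in> MM A)"

end

theory Submission imports Defs begin

text \<open>
  The heart of the matter is that adjointable maps \<open>A \<rightarrow> \<ell>\<^sup>2(A)\<close> are the same thing as columns
  \<open>a \<mapsto> (\<beta> i o\<^sub>L a)\<^sub>i\<close> with \<open>\<beta>\<close> in the multiplier module (\<open>adjointable_column\<close> and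
  \<open>column_of_adjointable\<close>), and that adjointable maps \<open>A \<rightarrow> A\<close> are the same thing as left
  multiplications by elements of \<open>MM A\<close> (\<open>adjointable_iff_multiplier\<close>). Composing \<open>\<Gamma>\<close> with the column
  \<open>\<beta>\<close> gives the map \<open>a \<mapsto> \<Sum> adj (G i) o\<^sub>L \<beta> i o\<^sub>L a\<close>. So \<open>\<Gamma>\<close> is locally adjointable iff for
  every such \<open>\<beta>\<close> the left strict limit of \<open>\<Sum> adj (G i) o\<^sub>L \<beta> i\<close> exists and belongs to \<open>MM A\<close>.

  What remains is that the coefficients of a locally adjointable \<open>\<Gamma>\<close> satisfy the other two
  conditions. Composing \<open>\<Gamma>\<close> with the \<open>i\<close>-th coordinate embedding shows that \<open>G i\<close> is a two-sided
  multiplier. For the partial sums \<open>S\<close> of \<open>\<Sum> adj (G i) o\<^sub>L G i\<close>, the truncated sequence \<open>G i o\<^sub>L a\<close>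
  is sent to \<open>S o\<^sub>L a\<close>, which yields \<open>norm (S o\<^sub>L a) \<le> K\<^sup>2 * norm a\<close> for a bound \<open>K\<close> of \<open>\<Gamma>\<close>.

  Two analytic facts carry this. The first, \<open>multiplier_of_adjointable\<close>, extends an adjointable map
  of \<open>A\<close> to an operator on the Hilbert space of at most the same norm; it replaces an approximate
  unit by the inequality \<open>(norm (P \<xi>))\<^sup>2 \<le> norm (P\<^sup>2 \<xi>) * norm \<xi>\<close> for symmetric \<open>P\<close>, iterated. It
  also gives the bound on \<open>S\<close> from that on \<open>S o\<^sub>L a\<close>. The second is the Cauchy-Schwarz inequality for
  columns of operators, by which \<open>\<Sum> adj (\<beta> i) o\<^sub>L x i\<close> converges in norm for \<open>x\<close> in \<open>\<ell>\<^sup>2(A)\<close>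
  as soon as the partial sums of \<open>\<Sum> adj (\<beta> i) o\<^sub>L \<beta> i\<close> are bounded (\<open>summable_adj_compose\<close>).
\<close>

section \<open>A growth argument and Riesz representation\<close>

text \<open>
  The substitute for a spectral radius argument. Iterating the doubling inequality gives
  \<open>r 1 ^ 2 ^ m \<le> r (2 ^ m) * r 0 ^ (2 ^ m - 1)\<close>; together with geometric growth, the
  \<open>2 ^ m\<close>-th roots absorb the constant \<open>C\<close> as \<open>m\<close> grows. For \<open>r k = norm (P\<^sup>k \<xi>)\<close> with \<open>P\<close>
  symmetric, it turns a bound on \<open>P\<close> with a constant depending on \<open>\<xi>\<close> into a uniform one.
\<close>
lemma power_trick:
  fixes r :: "nat \<Rightarrow> real"
  assumes nonneg: "\<And>k. 0 \<le> r k"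
    and double: "\<And>k. (r k)\<^sup>2 \<le> r (2 * k) * r 0"
    and growth: "\<And>k. r k \<le> C * L ^ k" and "0 \<le> L"
  shows "r 1 \<le> L * r 0"
proof (rule ccontr)
  assume "\<not> r 1 \<le> L * r 0"
  then have less: "L * r 0 < r 1" by simp
  have "r 0 \<noteq> 0"
  proof
    assume "r 0 = 0"
    then have "r 1 = 0" using double[of 1] by simp
    then show False using less \<open>r 0 = 0\<close> by simp
  qed
  then have r0: "0 < r 0" using nonneg[of 0] by simp
  have "L \<noteq> 0"
  proof
    assume "L = 0"
    then have "r 1 \<le> 0" using growth[of 1] by simp
    then show False using less \<open>L = 0\<close> by simp
  qed
  then have L: "0 < L" using \<open>0 \<le> L\<close> by simp
  have iter: "r 1 ^ (2 ^ m) * r 0 \<le> r (2 ^ m) * r 0 ^ (2 ^ m)" for m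
  proof (induction m)
    case 0
    show ?case by simp
  next
    case (Suc m)
    have "r 0 * (r 1 ^ (2 ^ Suc m) * r 0) = (r 1 ^ (2 ^ m) * r 0)\<^sup>2"
      by (simp add: power_mult power2_eq_square power_mult_distrib algebra_simps)
    also have "\<dots> \<le> (r (2 ^ m) * r 0 ^ (2 ^ m))\<^sup>2"
      using Suc nonneg r0 by (intro power_mono) auto
    also have "\<dots> = (r (2 ^ m))\<^sup>2 * r 0 ^ (2 ^ Suc m)"
      by (simp add: power_mult_distrib power_mult[symmetric] mult.commute)
    also have "\<dots> \<le> (r (2 * 2 ^ m) * r 0) * r 0 ^ (2 ^ Suc m)"
      using double r0 by (intro mult_right_mono) auto
    also have "\<dots> = r 0 * (r (2 ^ Suc m) * r 0 ^ (2 ^ Suc m))" by simp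
    finally show ?case using r0 by (simp only: mult_le_cancel_left_pos)
  qed
  define q where "q = r 1 / (L * r 0)"
  have q: "1 < q" using less L r0 by (simp add: q_def)
  have bound: "q ^ (2 ^ m) \<le> C / r 0" for m
  proof -
    have "r 1 ^ (2 ^ m) * r 0 \<le> (C * L ^ (2 ^ m)) * r 0 ^ (2 ^ m)"
      using iter[of m] growth[of "2 ^ m"] r0
      by (meson mult_right_mono order_trans zero_le_power less_imp_le)
    then show ?thesis
      using L r0 by (simp add: q_def power_divide power_mult_distrib field_simps)
  qed
  obtain n where n: "C / r 0 < q ^ n" using real_arch_pow[OF q] by blast
  have "q ^ n \<le> q ^ (2 ^ n)" using q by (intro power_increasing) (auto intro: less_imp_le)
  then show False using bound[of n] n by simp
qed

text \<open>
  The representing vector minimises \<open>(norm x)\<^sup>2 / 2 - f x\<close>: by the parallelogram law a minimising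
  sequence is Cauchy, and the first variation at the minimum is \<open>inner y v - f v\<close>.
\<close>
lemma riesz_representation:
  fixes f :: "'a::{real_inner, complete_space} \<Rightarrow> real"
  assumes f: "bounded_linear f"
  obtains y where "\<And>x. f x = inner y x"
proof -
  interpret f: bounded_linear f by fact
  obtain K where K: "\<And>x. norm (f x) \<le> norm x * K" using f.bounded by blast
  define J where "J x = (norm x)\<^sup>2 / 2 - f x" for x
  have lower: "- K\<^sup>2 / 2 \<le> J x" for x
  proof -
    have "0 \<le> (norm x - K)\<^sup>2" by simp
    moreover have "f x \<le> norm x * K" using K[of x] by simp
    ultimately show ?thesis
      unfolding J_def by (simp add: power2_diff)
  qed
  define m where "m = Inf (range J)"
  have bdd: "bdd_below (range J)" using lower by (rule bdd_belowI2)
  have m_le: "m \<le> J x" for x unfolding m_def using bdd by (auto intro: cInf_lower)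
  have "\<exists>x. J x < m + inverse (real (Suc n))" for n
    using cInf_less_iff[OF _ bdd, of "m + inverse (real (Suc n))"] unfolding m_def by auto
  then obtain X where X: "\<And>n. J (X n) < m + inverse (real (Suc n))" by metis
  have parallelogram: "J x + J y = 2 * J ((1/2) *\<^sub>R (x + y)) + (norm (x - y))\<^sup>2 / 4" for x y
    unfolding J_def power2_norm_eq_inner
    by (simp add: f.add f.scaleR inner_simps inner_commute field_simps)
  have close: "(norm (X j - X k))\<^sup>2 \<le> 4 * inverse (real (Suc j)) + 4 * inverse (real (Suc k))" for j k
  proof -
    have "p \<le> 4 * e + 4 * e'"
      if "u + v = 2 * w + p / 4" "m \<le> w" "u < m + e" "v < m + e'" for p u v w e e' :: real
      using that by (simp add: field_simps)
    from this[OF parallelogram m_le X X] show ?thesis .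
  qed
  have "Cauchy X"
  proof (rule metric_CauchyI)
    fix e :: real assume e: "0 < e"
    then obtain N where N: "inverse (real (Suc N)) < e\<^sup>2 / 8"
      using reals_Archimedean[of "e\<^sup>2 / 8"] by auto
    have "dist (X j) (X k) < e" if "N \<le> j" "N \<le> k" for j k
    proof -
      have "inverse (real (Suc j)) \<le> inverse (real (Suc N))"
           "inverse (real (Suc k)) \<le> inverse (real (Suc N))"
        using that by (auto intro!: le_imp_inverse_le)
      then have "(norm (X j - X k))\<^sup>2 < e\<^sup>2" using close[of j k] N by linarith
      then show ?thesis using e by (simp add: dist_norm power2_less_imp_less)
    qed
    then show "\<exists>M. \<forall>j\<ge>M. \<forall>k\<ge>M. dist (X j) (X k) < e" by blast
  qed
  then obtain y where y: "X \<longlonglongrightarrow> y" using Cauchy_convergent convergent_def by blast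
  have "(\<lambda>n. J (X n)) \<longlonglongrightarrow> J y"
    unfolding J_def by (intro tendsto_intros y f.tendsto) auto
  moreover have "(\<lambda>n. m + inverse (real (Suc n))) \<longlonglongrightarrow> m + 0"
    by (intro tendsto_intros LIMSEQ_inverse_real_of_nat)
  ultimately have "J y \<le> m + 0"
    by (rule LIMSEQ_le) (use X less_imp_le in blast)
  then have Jy: "J y \<le> m" by simp
  have "f v = inner y v" for v
  proof -
    define d where "d = inner y v - f v"
    \<comment> \<open>this step length minimises the quadratic polynomial below when \<open>v \<noteq> 0\<close>\<close>
    define t where "t = - d / ((norm v)\<^sup>2 + 1)"
    have "J y \<le> J (y + t *\<^sub>R v)" using Jy m_le order_trans by blast
    moreover have "J (y + t *\<^sub>R v) = J y + (t * d + t\<^sup>2 * (norm v)\<^sup>2 / 2)"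
      unfolding J_def d_def power2_norm_eq_inner
      by (simp add: f.add f.scaleR inner_simps inner_commute algebra_simps power2_eq_square)
    ultimately have "0 \<le> t * d + t\<^sup>2 * (norm v)\<^sup>2 / 2" by simp
    also have "\<dots> \<le> t * d + t\<^sup>2 * ((norm v)\<^sup>2 + 1) / 2"
      by (simp add: mult_left_mono)
    also have "\<dots> = - d\<^sup>2 / (2 * ((norm v)\<^sup>2 + 1))"
    proof -
      have pos: "(norm v)\<^sup>2 + 1 \<noteq> 0" by (smt (verit) zero_le_power2)
      have "d = - t * ((norm v)\<^sup>2 + 1)" unfolding t_def using pos by simp
      moreover have "u * e + u\<^sup>2 * q / 2 = - e\<^sup>2 / (2 * q)" if "e = - u * q" "q \<noteq> 0" for u e q :: real
        using that by (simp add: power2_eq_square field_simps)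
      ultimately show ?thesis using pos by blast
    qed
    finally have "d\<^sup>2 \<le> 0"
      by (smt (verit) divide_neg_pos zero_le_power2)
    then show ?thesis unfolding d_def by simp
  qed
  then show thesis using that by blast
qed

lemma le_if_square_le:
  fixes p q :: real
  assumes "p * p \<le> q * p" "0 \<le> p" "0 \<le> q"
  shows "p \<le> q"
  using assms by (cases "p = 0") (auto simp: mult_le_cancel_right)

lemma norm_blinfun_le_inner:
  fixes T :: "'a::real_inner \<Rightarrow>\<^sub>L 'a"
  assumes "\<And>x y. inner x (blinfun_apply T y) \<le> B * norm x * norm y" "0 \<le> B"
  shows "norm T \<le> B"
proof (rule norm_blinfun_bound[OF assms(2)])
  fix y
  have "norm (T y) * norm (T y) \<le> (B * norm y) * norm (T y)"
    using assms(1)[of "T y" y] by (simp add: dot_square_norm power2_eq_square ac_simps)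
  then show "norm (T y) \<le> B * norm y"
    by (rule le_if_square_le) (simp_all add: assms(2))
qed

section \<open>Operators and their adjoints\<close>

lemma Im_cinner: "Im (cinner x y) = - inner x (\<i> *\<^sub>C y)" for x :: "'h::complex_hilbert_space"
  using Re_cinner[of x "\<i> *\<^sub>C y"] by (simp add: cinner_scaleC_right)

lemma cinner_scaleC_left: "cinner (c *\<^sub>C x) y = cnj c * cinner x y"
  for x :: "'h::complex_hilbert_space"
  by (metis cinner_commute cinner_scaleC_right complex_cnj_cnj complex_cnj_mult)

lemma inner_scaleC: "inner (c *\<^sub>C x) y = inner x (cnj c *\<^sub>C y)"
  for x :: "'h::complex_hilbert_space"
  by (metis Re_cinner cinner_scaleC_left cinner_scaleC_right)

lemma norm_scaleC: "norm (c *\<^sub>C x) = cmod c * norm x" for x :: "'h::complex_hilbert_space"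
proof -
  have "inner (c *\<^sub>C x) (c *\<^sub>C x) = inner x ((complex_of_real ((cmod c)\<^sup>2)) *\<^sub>C x)"
    unfolding inner_scaleC scaleC_scaleC
    by (metis complex_norm_square mult.commute of_real_power)
  then show ?thesis unfolding scaleC_of_real
    by (simp add: norm_eq_sqrt_inner real_sqrt_mult)
qed

lemma scaleC_scaleR: "c *\<^sub>C (r *\<^sub>R x) = r *\<^sub>R (c *\<^sub>C x)" for x :: "'h::complex_hilbert_space"
  by (metis mult.commute scaleC_of_real scaleC_scaleC)

lemma bounded_linear_scaleC: "bounded_linear (\<lambda>x::'h::complex_hilbert_space. c *\<^sub>C x)"
proof (rule bounded_linear_intro)
  show "norm (c *\<^sub>C x) \<le> norm x * cmod c" for x :: 'h by (simp add: norm_scaleC)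
qed (rule scaleC_add_right scaleC_scaleR)+

lemma op_scaleC_apply [simp]: "blinfun_apply (op_scaleC c T) x = c *\<^sub>C blinfun_apply T x"
  unfolding op_scaleC_def
  by (subst bounded_linear_Blinfun_apply)
     (auto intro: bounded_linear_compose[OF bounded_linear_scaleC] blinfun.bounded_linear_right)

lemma op_scaleC_of_real: "op_scaleC (complex_of_real r) T = r *\<^sub>R T"
  by (rule blinfun_eqI) (simp add: scaleC_of_real blinfun.scaleR_left)

lemma BH_scaleC: "T \<in> BH \<Longrightarrow> blinfun_apply T (c *\<^sub>C x) = c *\<^sub>C blinfun_apply T x"
  by (simp add: BH_def)

lemma adjoint_exists:
  fixes T :: "'h::complex_hilbert_space bop"
  obtains S :: "'h bop" where "\<And>x y. inner (blinfun_apply T x) y = inner x (blinfun_apply S y)"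
proof -
  have "\<exists>z. \<forall>x. inner (T x) y = inner z x" for y
    by (rule riesz_representation[of "\<lambda>x. inner (T x) y"])
       (auto intro!: bounded_linear_inner_left_comp blinfun.bounded_linear_right)
  then obtain S where "\<And>y x. inner (T x) y = inner (S y) x" by metis
  then have S: "inner (T x) y = inner x (S y)" for x y by (simp add: inner_commute)
  have "bounded_linear S"
  proof (rule bounded_linear_intro)
    show "S (x + y) = S x + S y" for x y
      by (rule vector_eq_rdot[THEN iffD1]) (metis S inner_add_right inner_commute)
    show "S (r *\<^sub>R x) = r *\<^sub>R S x" for r x
      by (rule vector_eq_rdot[THEN iffD1]) (metis S inner_scaleR_right inner_commute)
    show "norm (S y) \<le> norm y * norm T" for y
    proof -
      have "norm (S y) * norm (S y) = inner (T (S y)) y"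
        by (simp add: S dot_square_norm power2_eq_square)
      also have "\<dots> \<le> norm (T (S y)) * norm y" by (rule norm_cauchy_schwarz)
      also have "\<dots> \<le> (norm T * norm (S y)) * norm y"
        by (intro mult_right_mono norm_blinfun norm_ge_zero)
      finally have "norm (S y) * norm (S y) \<le> (norm y * norm T) * norm (S y)"
        by (simp add: ac_simps)
      then show ?thesis
        by (rule le_if_square_le) simp_all
    qed
  qed
  then have "blinfun_apply (Blinfun S) = S" by (rule bounded_linear_Blinfun_apply)
  then show thesis using S that[of "Blinfun S"] by simp
qed

text \<open>
  The complex inner product is determined by the real one through \<open>Im_cinner\<close>, so for a
  complex-linear operator the real adjoint is also the complex one. It follows that the calculus of
  adjoints can be done with real inner products.
\<close>
lemma adj_eqI:
  assumes "T \<in> BH" and S: "\<And>x y. inner (blinfun_apply T x) y = inner x (blinfun_apply S y)"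
  shows "adj T = S"
proof -
  have c: "cinner (T x) y = cinner x (S y)" for x y
  proof (rule complex_eqI)
    show "Re (cinner (T x) y) = Re (cinner x (S y))" by (simp add: Re_cinner S)
    have "inner (T x) (\<i> *\<^sub>C y) = inner (T (cnj \<i> *\<^sub>C x)) y"
      by (simp add: BH_scaleC[OF assms(1)] inner_scaleC)
    also have "\<dots> = inner x (\<i> *\<^sub>C S y)" by (simp add: S inner_scaleC)
    finally show "Im (cinner (T x) y) = Im (cinner x (S y))" by (simp add: Im_cinner)
  qed
  show ?thesis unfolding adj_def
  proof (rule the_equality)
    show "\<forall>x y. cinner (T x) y = cinner x (S y)" using c by blast
    fix S' assume S': "\<forall>x y. cinner (T x) y = cinner x (blinfun_apply S' y)"
    show "S' = S"
    proof (rule blinfun_eqI)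
      fix y
      have "inner (S' y) x = inner (S y) x" for x
        by (metis Re_cinner S S' inner_commute)
      then show "S' y = S y" by (metis vector_eq_rdot inner_commute)
    qed
  qed
qed

lemma inner_adj: "T \<in> BH \<Longrightarrow> inner (blinfun_apply T x) y = inner x (blinfun_apply (adj T) y)"
  using adjoint_exists[of T] adj_eqI by metis

lemma inner_adj': "T \<in> BH \<Longrightarrow> inner (blinfun_apply (adj T) x) y = inner x (blinfun_apply T y)"
  by (metis inner_adj inner_commute)

lemma adj_BH: assumes "T \<in> BH" shows "adj T \<in> BH"
proof -
  have "adj T (c *\<^sub>C y) = c *\<^sub>C adj T y" for c y
  proof (rule vector_eq_rdot[THEN iffD1], rule allI)
    fix x
    have "inner x (adj T (c *\<^sub>C y)) = inner (T (cnj c *\<^sub>C x)) y"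
      by (simp add: inner_adj[OF assms, symmetric] BH_scaleC[OF assms] inner_scaleC)
    also have "\<dots> = inner x (c *\<^sub>C adj T y)"
      by (simp add: inner_adj[OF assms] inner_scaleC)
    finally show "inner (adj T (c *\<^sub>C y)) x = inner (c *\<^sub>C adj T y) x"
      by (simp add: inner_commute)
  qed
  then show ?thesis by (simp add: BH_def)
qed

lemma BH_0: "0 \<in> BH"
  by (auto simp: BH_def) (metis norm_eq_zero norm_scaleC mult_zero_right)

lemma BH_add: "S \<in> BH \<Longrightarrow> T \<in> BH \<Longrightarrow> S + T \<in> BH"
  by (simp add: BH_def blinfun.add_left scaleC_add_right)

lemma BH_compose: "S \<in> BH \<Longrightarrow> T \<in> BH \<Longrightarrow> S o\<^sub>L T \<in> BH"
  by (simp add: BH_def)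

lemma BH_sum: "(\<And>i. i \<in> I \<Longrightarrow> T i \<in> BH) \<Longrightarrow> sum T I \<in> BH"
  by (induction I rule: infinite_finite_induct) (auto simp: BH_0 BH_add)

lemma adj_adj: "T \<in> BH \<Longrightarrow> adj (adj T) = T"
  by (rule adj_eqI) (auto simp: adj_BH inner_adj')

lemma adj_0: "adj 0 = 0"
  by (rule adj_eqI) (auto simp: BH_0)

lemma adj_add: "S \<in> BH \<Longrightarrow> T \<in> BH \<Longrightarrow> adj (S + T) = adj S + adj T"
  by (rule adj_eqI) (auto simp: BH_add inner_adj blinfun.add_left inner_simps)

lemma adj_compose: "S \<in> BH \<Longrightarrow> T \<in> BH \<Longrightarrow> adj (S o\<^sub>L T) = adj T o\<^sub>L adj S"
  by (rule adj_eqI) (auto simp: BH_compose inner_adj)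

lemma adj_sum: "(\<And>i. i \<in> I \<Longrightarrow> T i \<in> BH) \<Longrightarrow> adj (sum T I) = (\<Sum>i\<in>I. adj (T i))"
  by (induction I rule: infinite_finite_induct) (auto simp: adj_0 adj_add BH_sum)

lemma norm_adj: assumes "T \<in> BH" shows "norm (adj T) = norm T"
proof -
  have le: "norm (adj S) \<le> norm S" if "S \<in> BH" for S :: "'a bop"
  proof (rule norm_blinfun_le_inner)
    fix x y
    have "inner x (adj S y) = inner (S x) y" using that by (simp add: inner_adj)
    also have "\<dots> \<le> norm (S x) * norm y" by (rule norm_cauchy_schwarz)
    also have "\<dots> \<le> norm S * norm x * norm y" by (intro mult_right_mono norm_blinfun) auto
    finally show "inner x (adj S y) \<le> norm S * norm x * norm y" .
  qed simp
  from le[OF assms] le[OF adj_BH[OF assms]] show ?thesis by (simp add: adj_adj assms)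
qed

lemma norm_adj_compose: assumes "T \<in> BH" shows "norm (adj T o\<^sub>L T) = (norm T)\<^sup>2"
proof (rule antisym)
  show "norm (adj T o\<^sub>L T) \<le> (norm T)\<^sup>2"
    using norm_blinfun_compose[of "adj T" T] by (simp add: norm_adj assms power2_eq_square)
  have "norm T \<le> sqrt (norm (adj T o\<^sub>L T))"
  proof (rule norm_blinfun_bound)
    fix x
    have "(norm (T x))\<^sup>2 = inner x ((adj T o\<^sub>L T) x)"
      by (simp add: inner_adj[OF assms] power2_norm_eq_inner)
    also have "\<dots> \<le> norm x * norm ((adj T o\<^sub>L T) x)" by (rule norm_cauchy_schwarz)
    also have "\<dots> \<le> norm x * (norm (adj T o\<^sub>L T) * norm x)"
      by (intro mult_left_mono norm_blinfun) auto
    also have "\<dots> = (sqrt (norm (adj T o\<^sub>L T)) * norm x)\<^sup>2"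
      by (simp add: power_mult_distrib power2_eq_square)
    finally show "norm (T x) \<le> sqrt (norm (adj T o\<^sub>L T)) * norm x"
      by (rule power2_le_imp_le) simp
  qed simp
  then show "(norm T)\<^sup>2 \<le> norm (adj T o\<^sub>L T)"
    using power_mono[of "norm T" _ 2] by fastforce
qed

section \<open>Bounded operators from bounded relations\<close>

instance complex_hilbert_space \<subseteq> banach ..

lemma subspace_closure:
  fixes S :: "'a::real_normed_vector set"
  assumes "subspace S"
  shows "subspace (closure S)"
proof (rule subspaceI)
  show "0 \<in> closure S" using subspace_0[OF assms] closure_subset by blast
  show "x + y \<in> closure S" if xy: "x \<in> closure S" "y \<in> closure S" for x y
  proof -
    obtain f where "\<And>n. f n \<in> S" "f \<longlonglongrightarrow> x" using xy(1) by (metis closure_sequential)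
    moreover obtain g where "\<And>n. g n \<in> S" "g \<longlonglongrightarrow> y" using xy(2) by (metis closure_sequential)
    ultimately show ?thesis
      unfolding closure_sequential
      by (intro exI[of _ "\<lambda>n. f n + g n"]) (auto intro: subspace_add[OF assms] tendsto_add)
  qed
  show "r *\<^sub>R x \<in> closure S" if x: "x \<in> closure S" for r x
  proof -
    obtain f where "\<And>n. f n \<in> S" "f \<longlonglongrightarrow> x" using x by (metis closure_sequential)
    then show ?thesis
      unfolding closure_sequential
      by (intro exI[of _ "\<lambda>n. r *\<^sub>R f n"]) (auto intro: subspace_scale[OF assms] tendsto_intros)
  qed
qed

text \<open>
  The closure of \<open>span S\<close> is the graph of \<open>R\<close>. The bound makes it single-valued, and together with
  completeness it shows that its projection to the first coordinate is closed, hence everything.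
\<close>
lemma blinfun_of_bounded_relation:
  fixes S :: "('a::banach \<times> 'b::banach) set"
  assumes bound: "\<And>w. w \<in> span S \<Longrightarrow> norm (snd w) \<le> K * norm (fst w)" and "0 \<le> K"
    and dense: "closure (fst ` span S) = UNIV"
  obtains R :: "'a \<Rightarrow>\<^sub>L 'b"
  where "\<And>x y. (x, y) \<in> S \<Longrightarrow> blinfun_apply R x = y" "norm R \<le> K"
proof -
  define V where "V = closure (span S)"
  have sub: "subspace V" unfolding V_def by (intro subspace_closure subspace_span)
  have boundV: "norm (snd v) \<le> K * norm (fst v)" if "v \<in> V" for v
  proof -
    have "closed {v::'a \<times> 'b. norm (snd v) \<le> K * norm (fst v)}"
      by (intro closed_Collect_le continuous_intros)
    then have "V \<subseteq> {v. norm (snd v) \<le> K * norm (fst v)}"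
      unfolding V_def using bound by (intro closure_minimal) auto
    then show ?thesis using that by blast
  qed
  have unique: "y = y'" if "(x, y) \<in> V" "(x, y') \<in> V" for x y y'
    using boundV[OF subspace_diff[OF sub that]] by simp
  have "\<exists>y. (x, y) \<in> V" for x
  proof -
    obtain f where f: "\<And>n. f n \<in> fst ` span S" "f \<longlonglongrightarrow> x"
      using dense closure_sequential[of x "fst ` span S"] by blast
    then obtain w where w: "\<And>n. w n \<in> span S" "\<And>n. f n = fst (w n)"
      unfolding image_iff by metis
    have "Cauchy f" using f(2) by (rule LIMSEQ_imp_Cauchy)
    have "Cauchy (\<lambda>n. snd (w n))"
    proof (rule metric_CauchyI)
      fix e :: real assume e: "0 < e"
      then have "0 < e / (K + 1)" using \<open>0 \<le> K\<close> by simp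
      then obtain N where N: "\<And>m n. N \<le> m \<Longrightarrow> N \<le> n \<Longrightarrow> dist (f m) (f n) < e / (K + 1)"
        using \<open>Cauchy f\<close> unfolding Cauchy_def by meson
      have "dist (snd (w m)) (snd (w n)) < e" if "N \<le> m" "N \<le> n" for m n
      proof -
        have "dist (snd (w m)) (snd (w n)) \<le> K * dist (f m) (f n)"
          using bound[OF span_diff[OF w(1)[of m] w(1)[of n]]] by (simp add: dist_norm w(2))
        also have "\<dots> \<le> (K + 1) * dist (f m) (f n)" by (intro mult_right_mono) auto
        also have "\<dots> < e" using N[OF that] \<open>0 \<le> K\<close> by (simp add: field_simps)
        finally show ?thesis .
      qed
      then show "\<exists>M. \<forall>m\<ge>M. \<forall>n\<ge>M. dist (snd (w m)) (snd (w n)) < e" by blast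
    qed
    then obtain y where y: "(\<lambda>n. snd (w n)) \<longlonglongrightarrow> y" using Cauchy_convergent convergent_def by blast
    have "(\<lambda>n. (fst (w n), snd (w n))) \<longlonglongrightarrow> (x, y)"
      using f(2) y by (intro tendsto_Pair) (simp_all add: w(2)[symmetric])
    then have "(x, y) \<in> V"
      unfolding V_def closure_sequential using w(1) by auto
    then show ?thesis by blast
  qed
  then obtain R where R: "\<And>x. (x, R x) \<in> V" by metis
  have "bounded_linear R"
  proof (rule bounded_linear_intro)
    show "R (x + y) = R x + R y" for x y
      using unique[OF R] subspace_add[OF sub R[of x] R[of y]] by simp
    show "R (r *\<^sub>R x) = r *\<^sub>R R x" for r x
      using unique[OF R] subspace_scale[OF sub R[of x], of r] by simp
    show "norm (R x) \<le> norm x * K" for x using boundV[OF R[of x]] by (simp add: mult.commute)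
  qed
  then have apply_R: "blinfun_apply (Blinfun R) = R" by (rule bounded_linear_Blinfun_apply)
  show thesis
  proof (rule that[of "Blinfun R"])
    show "Blinfun R x = y" if "(x, y) \<in> S" for x y
    proof -
      have "(x, y) \<in> V" unfolding V_def using that closure_subset span_superset by blast
      then show ?thesis using unique[OF R] by (simp add: apply_R)
    qed
    show "norm (Blinfun R) \<le> K"
      using boundV[OF R] \<open>0 \<le> K\<close> by (intro norm_blinfun_bound) (simp_all add: apply_R)
  qed
qed

section \<open>Adjointable maps of the algebra and multipliers\<close>

context nondegenerate_cstar_algebra
begin

lemma mem_BH: "a \<in> A \<Longrightarrow> a \<in> BH"
  using subset_BH by blast

lemma scaleR_mem: "a \<in> A \<Longrightarrow> r *\<^sub>R a \<in> A"
  using scale_mem[of a "complex_of_real r"] by (simp add: op_scaleC_of_real)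

lemma diff_mem: "a \<in> A \<Longrightarrow> b \<in> A \<Longrightarrow> a - b \<in> A"
  using add_mem[of a "(-1) *\<^sub>R b"] scaleR_mem[of b "-1"] by simp

lemma sum_mem: "(\<And>i. i \<in> I \<Longrightarrow> x i \<in> A) \<Longrightarrow> sum x I \<in> A"
  by (induction I rule: infinite_finite_induct) (auto simp: zero_mem add_mem)

lemma lim_mem: "(\<And>n. x n \<in> A) \<Longrightarrow> x \<longlonglongrightarrow> y \<Longrightarrow> y \<in> A"
  using closed closed_sequential_limits by blast

lemma suminf_mem: "(\<And>i. x i \<in> A) \<Longrightarrow> summable x \<Longrightarrow> suminf x \<in> A"
  by (rule lim_mem[of "\<lambda>n. \<Sum>i<n. x i"]) (auto intro: sum_mem summable_LIMSEQ)

lemma span_range_induct [consumes 1, case_names base zero add scale]: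
  assumes "x \<in> span {blinfun_apply a \<xi> | a \<xi>. a \<in> A}"
    and "\<And>a \<xi>. a \<in> A \<Longrightarrow> P (blinfun_apply a \<xi>)" and "P 0"
    and "\<And>x y. P x \<Longrightarrow> P y \<Longrightarrow> P (x + y)"
    and "\<And>r x. P x \<Longrightarrow> P (r *\<^sub>R x)"
  shows "P x"
  using assms(1)
proof (rule span_induct)
  show "subspace (Collect P)" using assms(3-) by (auto intro: subspaceI)
qed (use assms(2) in auto)

lemma dense_induct:
  assumes "closed {x. P x}" and "\<And>x. x \<in> span {blinfun_apply a \<xi> | a \<xi>. a \<in> A} \<Longrightarrow> P x"
  shows "P x"
proof -
  have "closure (span {blinfun_apply a \<xi> | a \<xi>. a \<in> A}) \<subseteq> {x. P x}"
    using assms by (intro closure_minimal) auto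
  then show ?thesis using nondegenerate by auto
qed

lemma blinfun_eq_if_compose_eq:
  assumes eq: "\<And>a. a \<in> A \<Longrightarrow> S o\<^sub>L a = T o\<^sub>L a"
  shows "S = T"
proof (rule blinfun_eqI)
  fix x
  show "S x = T x"
  proof (rule dense_induct[where P = "\<lambda>x. S x = T x"])
    show "closed {x. S x = T x}" by (intro closed_Collect_eq continuous_intros)
    show "S x = T x" if "x \<in> span {blinfun_apply a \<xi> | a \<xi>. a \<in> A}" for x
      using that
    proof (induction rule: span_range_induct)
      case (base a \<xi>)
      then show ?case using eq[OF base] by (metis blinfun_apply_blinfun_compose)
    qed (auto simp: blinfun.add_right blinfun.scaleR_right)
  qed
qed

text \<open>
  Vectors of the form \<open>a \<xi>\<close> are total, so they separate the values of \<open>S\<close> and \<open>T\<close> from the left.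
\<close>
lemma blinfun_eq_if_adj_compose_eq:
  assumes eq: "\<And>a. a \<in> A \<Longrightarrow> adj a o\<^sub>L S = adj a o\<^sub>L T"
  shows "S = T"
proof (rule blinfun_eqI)
  fix y
  have "inner x (S y) = inner x (T y)" for x
  proof (rule dense_induct[where P = "\<lambda>x. inner x (S y) = inner x (T y)"])
    show "closed {x. inner x (S y) = inner x (T y)}" by (intro closed_Collect_eq continuous_intros)
    show "inner x (S y) = inner x (T y)" if "x \<in> span {blinfun_apply a \<xi> | a \<xi>. a \<in> A}" for x
      using that
    proof (induction rule: span_range_induct)
      case (base a \<xi>)
      then show ?case using eq[OF base] by (metis blinfun_apply_blinfun_compose inner_adj mem_BH)
    qed (auto simp: inner_simps)
  qed
  then show "S y = T y" by (metis vector_eq_ldot)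
qed

lemma MM_BH: "T \<in> MM A \<Longrightarrow> T \<in> BH"
  by (simp add: MM_def LM_def)

lemma MM_compose_mem: "T \<in> MM A \<Longrightarrow> a \<in> A \<Longrightarrow> T o\<^sub>L a \<in> A"
  by (simp add: MM_def LM_def)

lemma adj_RM_compose_mem: assumes "T \<in> RM A" "a \<in> A" shows "adj T o\<^sub>L a \<in> A"
proof -
  have "T \<in> BH" using assms by (simp add: RM_def)
  moreover have "adj a o\<^sub>L T \<in> A" using assms by (simp add: RM_def adj_mem)
  ultimately show ?thesis
    using adj_mem[of "adj a o\<^sub>L T"] assms by (simp add: adj_compose adj_BH adj_adj mem_BH)
qed

lemma RM_I:
  assumes "T \<in> BH" "\<And>a. a \<in> A \<Longrightarrow> adj T o\<^sub>L a \<in> A"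
  shows "T \<in> RM A"
proof -
  have "a o\<^sub>L T \<in> A" if "a \<in> A" for a
    using adj_mem[OF assms(2)[OF adj_mem[OF that]]] that assms(1)
    by (simp add: adj_compose adj_BH adj_adj mem_BH)
  then show ?thesis using assms by (simp add: RM_def)
qed

text \<open>
  The operator \<open>R\<close> must send \<open>a \<xi>\<close> to \<open>F a \<xi>\<close>, and the point is that this prescription is bounded by \<open>K\<close>
  on finite sums \<open>\<Sum> a\<^sub>s \<eta>\<^sub>s\<close>. Put \<open>P = F' \<circ> F\<close> and \<open>p k = \<Sum> P\<^sup>k(a\<^sub>s) \<eta>\<^sub>s\<close>. Since \<open>P\<close> is symmetric,
  \<open>(norm (p k))\<^sup>2 = inner (p (2 * k)) (p 0)\<close>, and \<open>norm (p k)\<close> grows at most like \<open>(K\<^sup>2) ^ k\<close>; so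
  \<open>power_trick\<close> gives \<open>norm (p 1) \<le> K\<^sup>2 * norm (p 0)\<close>. The squared norm of \<open>\<Sum> F(a\<^sub>s) \<eta>\<^sub>s\<close> is
  \<open>inner (p 0) (p 1)\<close>, which finishes the estimate without an approximate unit.
\<close>
lemma multiplier_of_adjointable:
  assumes F: "\<And>a. a \<in> A \<Longrightarrow> F a \<in> A" and F': "\<And>a. a \<in> A \<Longrightarrow> F' a \<in> A"
    and adj: "\<And>a b. a \<in> A \<Longrightarrow> b \<in> A \<Longrightarrow> adj (F a) o\<^sub>L b = adj a o\<^sub>L F' b"
    and bound: "\<And>a. a \<in> A \<Longrightarrow> norm (F a) \<le> K * norm a" and "0 \<le> K"
  obtains R where "R \<in> MM A" "norm R \<le> K" "\<And>a. a \<in> A \<Longrightarrow> F a = R o\<^sub>L a"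
proof -
  have adj': "adj (F' b) o\<^sub>L a = adj b o\<^sub>L F a" if "a \<in> A" "b \<in> A" for a b
  proof -
    have "adj (adj (F a) o\<^sub>L b) = adj (adj a o\<^sub>L F' b)" using adj that by simp
    then show ?thesis using that F F' by (simp add: adj_compose adj_BH adj_adj mem_BH)
  qed
  have bound': "norm (F' b) \<le> K * norm b" if b: "b \<in> A" for b
  proof -
    have "(norm (F' b))\<^sup>2 = norm (adj b o\<^sub>L F (F' b))"
      using adj'[OF F'[OF b] b] F'[OF b] by (metis norm_adj_compose mem_BH)
    also have "\<dots> \<le> norm b * norm (F (F' b))"
      using norm_blinfun_compose[of "adj b"] b by (simp add: norm_adj mem_BH)
    also have "\<dots> \<le> norm b * (K * norm (F' b))" by (intro mult_left_mono bound F' b) auto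
    finally have "norm (F' b) * norm (F' b) \<le> (K * norm b) * norm (F' b)"
      by (simp add: power2_eq_square ac_simps)
    then show ?thesis
      by (rule le_if_square_le) (simp_all add: \<open>0 \<le> K\<close>)
  qed
  define P where "P = F' \<circ> F"
  have P_mem: "(P ^^ k) a \<in> A" if "a \<in> A" for k a
    using that by (induction k) (auto simp: P_def F F')
  have P_adj: "adj ((P ^^ k) a) o\<^sub>L b = adj a o\<^sub>L (P ^^ k) b" if "a \<in> A" "b \<in> A" for k a b
    using that
  proof (induction k arbitrary: a)
    case (Suc k)
    have "P a \<in> A" using Suc.prems by (simp add: P_def F F')
    then have "adj ((P ^^ Suc k) a) o\<^sub>L b = adj (P a) o\<^sub>L (P ^^ k) b"
      using Suc by (simp add: funpow_swap1)
    also have "\<dots> = adj a o\<^sub>L P ((P ^^ k) b)"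
      using Suc.prems P_mem by (simp add: P_def adj adj' F F')
    finally show ?case by simp
  qed simp
  have P_bound: "norm ((P ^^ k) a) \<le> (K\<^sup>2) ^ k * norm a" if "a \<in> A" for k a
  proof (induction k)
    case (Suc k)
    have "norm ((P ^^ Suc k) a) \<le> K * (K * norm ((P ^^ k) a))"
    proof -
      have "norm (F' (F b)) \<le> K * (K * norm b)" if "b \<in> A" for b
        using bound'[OF F[OF that]] mult_left_mono[OF bound[OF that] \<open>0 \<le> K\<close>] by linarith
      from this[OF P_mem[OF that]] show ?thesis by (simp add: P_def)
    qed
    also have "\<dots> \<le> K * (K * ((K\<^sup>2) ^ k * norm a))"
      using Suc \<open>0 \<le> K\<close> by (intro mult_left_mono) auto
    finally show ?case by (simp add: power2_eq_square ac_simps)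
  qed simp
  define S where "S = {(blinfun_apply a \<xi>, blinfun_apply (F a) \<xi>) | a \<xi>. a \<in> A}"
  have span_bound: "norm (snd w) \<le> K * norm (fst w)" if "w \<in> span S" for w
  proof -
    obtain t r where t: "finite t" "t \<subseteq> S" "w = (\<Sum>s\<in>t. r s *\<^sub>R s)"
      using \<open>w \<in> span S\<close> unfolding span_explicit by blast
    have "\<forall>s. \<exists>a \<xi>. s \<in> t \<longrightarrow> a \<in> A \<and> s = (blinfun_apply a \<xi>, blinfun_apply (F a) \<xi>)"
      using t(2) unfolding S_def by blast
    then obtain a \<xi> where a: "\<And>s. s \<in> t \<Longrightarrow> a s \<in> A"
      and s: "\<And>s. s \<in> t \<Longrightarrow> s = (blinfun_apply (a s) (\<xi> s), blinfun_apply (F (a s)) (\<xi> s))"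
      by metis
    \<comment> \<open>the scalar coefficients are moved into the vectors, so that \<open>F\<close> is only applied to the \<open>a s\<close>\<close>
    define \<eta> where "\<eta> s = r s *\<^sub>R \<xi> s" for s
    define p where "p k = (\<Sum>s\<in>t. blinfun_apply ((P ^^ k) (a s)) (\<eta> s))" for k
    have fst_s: "r s *\<^sub>R fst s = a s (\<eta> s)" if "s \<in> t" for s
      using arg_cong[OF s[OF that], of fst] by (simp add: \<eta>_def blinfun.scaleR_right)
    have snd_s: "r s *\<^sub>R snd s = F (a s) (\<eta> s)" if "s \<in> t" for s
      using arg_cong[OF s[OF that], of snd] by (simp add: \<eta>_def blinfun.scaleR_right)
    have fst_w: "fst w = p 0"
      unfolding t(3) p_def fst_sum by (intro sum.cong) (auto simp: fst_s)
    have snd_w: "snd w = (\<Sum>s\<in>t. F (a s) (\<eta> s))"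
      unfolding t(3) snd_sum by (intro sum.cong) (auto simp: snd_s)
    have inner_adj_A: "inner (blinfun_apply b x) (blinfun_apply c y)
        = inner x (blinfun_apply (adj b o\<^sub>L c) y)" if "b \<in> A" for b c x y
      using that by (simp add: inner_adj mem_BH)
    have "(norm (p k))\<^sup>2 \<le> norm (p (2 * k)) * norm (p 0)" for k
    proof -
      have "inner ((P ^^ k) (a s) x) ((P ^^ k) (a s') y) = inner ((P ^^ (2 * k)) (a s) x) (a s' y)"
        if "s \<in> t" "s' \<in> t" for s s' x y
      proof -
        have "(P ^^ (2 * k)) (a s) = (P ^^ k) ((P ^^ k) (a s))" by (simp add: mult_2 funpow_add)
        then show ?thesis using that a P_mem P_adj by (simp only: inner_adj_A)
      qed
      then have "inner (p k) (p k) = inner (p (2 * k)) (p 0)"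
        unfolding p_def inner_sum_left inner_sum_right by (intro sum.cong refl) auto
      then show ?thesis unfolding power2_norm_eq_inner using norm_cauchy_schwarz by metis
    qed
    moreover have "norm (p k) \<le> (\<Sum>s\<in>t. norm (a s) * norm (\<eta> s)) * (K\<^sup>2) ^ k" for k
    proof -
      have "norm (p k) \<le> (\<Sum>s\<in>t. (K\<^sup>2) ^ k * norm (a s) * norm (\<eta> s))"
        unfolding p_def using a P_bound
        by (intro sum_norm_le order_trans[OF norm_blinfun] mult_right_mono) auto
      then show ?thesis by (simp add: sum_distrib_left sum_distrib_right ac_simps)
    qed
    ultimately have p1: "norm (p 1) \<le> K\<^sup>2 * norm (p 0)"
      by (intro power_trick[where r = "\<lambda>k. norm (p k)"]) auto
    have "inner (F (a s) x) (F (a s') y) = inner (a s x) (P (a s') y)"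
      if "s \<in> t" "s' \<in> t" for s s' x y
      using a that by (simp only: inner_adj_A F F' adj P_def comp_apply)
    then have "inner (snd w) (snd w) = inner (p 0) (p 1)"
      unfolding snd_w p_def inner_sum_left inner_sum_right by (intro sum.cong refl) auto
    also have "\<dots> \<le> norm (p 0) * (K\<^sup>2 * norm (p 0))"
      by (rule order_trans[OF norm_cauchy_schwarz mult_left_mono[OF p1]]) simp
    finally have "(norm (snd w))\<^sup>2 \<le> (K * norm (fst w))\<^sup>2"
      by (simp add: power2_norm_eq_inner[symmetric] fst_w power_mult_distrib power2_eq_square ac_simps)
    then show ?thesis by (rule power2_le_imp_le) (simp add: \<open>0 \<le> K\<close>)
  qed
  have "{blinfun_apply a \<xi> | a \<xi>. a \<in> A} = fst ` S" unfolding S_def by force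
  moreover have "span (fst ` S) = fst ` span S"
    by (rule linear_span_image) (rule linear_fst)
  ultimately have "closure (fst ` span S) = UNIV" using nondegenerate by simp
  then obtain R where R: "\<And>x y. (x, y) \<in> S \<Longrightarrow> blinfun_apply R x = y" and "norm R \<le> K"
    using blinfun_of_bounded_relation[of S K] span_bound \<open>0 \<le> K\<close> by metis
  have eq: "F a = R o\<^sub>L a" if "a \<in> A" for a
  proof (rule blinfun_eqI)
    fix \<xi>
    have "(blinfun_apply a \<xi>, blinfun_apply (F a) \<xi>) \<in> S" unfolding S_def using that by blast
    then show "F a \<xi> = (R o\<^sub>L a) \<xi>" using R by simp
  qed
  have R_BH: "R \<in> BH"
  proof -
    have "R (c *\<^sub>C x) = c *\<^sub>C R x" for c x
    proof (rule dense_induct[where P = "\<lambda>x. R (c *\<^sub>C x) = c *\<^sub>C R x"])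
      show "closed {x. R (c *\<^sub>C x) = c *\<^sub>C R x}"
        by (intro closed_Collect_eq continuous_intros
            linear_continuous_on[OF bounded_linear_compose[OF bounded_linear_scaleC]]
            linear_continuous_on[OF bounded_linear_compose[OF _ bounded_linear_scaleC]]
            blinfun.bounded_linear_right)
      show "R (c *\<^sub>C x) = c *\<^sub>C R x" if "x \<in> span {blinfun_apply a \<xi> | a \<xi>. a \<in> A}" for x
        using that
      proof (induction rule: span_range_induct)
        case (base a \<xi>)
        have R_a: "R (a x) = F a x" for x using eq[OF base] by simp
        have "R (c *\<^sub>C a \<xi>) = R (a (c *\<^sub>C \<xi>))" using mem_BH[OF base] by (simp only: BH_scaleC)
        also have "\<dots> = c *\<^sub>C R (a \<xi>)" using mem_BH[OF F[OF base]] by (simp only: R_a BH_scaleC)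
        finally show ?case .
      qed (auto simp: blinfun.add_right scaleC_add_right scaleC_scaleR blinfun.scaleR_right
           linear_0[OF bounded_linear.linear[OF bounded_linear_scaleC]])
    qed
    then show ?thesis by (simp add: BH_def)
  qed
  have "adj R o\<^sub>L b = F' b" if b: "b \<in> A" for b
  proof (rule blinfun_eq_if_adj_compose_eq)
    fix a assume a: "a \<in> A"
    have "adj a o\<^sub>L (adj R o\<^sub>L b) = adj (R o\<^sub>L a) o\<^sub>L b"
      using a R_BH by (intro blinfun_eqI) (simp add: adj_compose mem_BH)
    then show "adj a o\<^sub>L (adj R o\<^sub>L b) = adj a o\<^sub>L F' b" using adj eq a b by metis
  qed
  then have "R \<in> RM A" using R_BH F' by (intro RM_I) auto
  moreover have "R \<in> LM A" using R_BH eq F by (auto simp: LM_def)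
  ultimately show thesis using that[of R] \<open>norm R \<le> K\<close> eq by (simp add: MM_def)
qed

end

section \<open>Columns of operators\<close>

text \<open>
  In other words, the column of the \<open>x i\<close>, as an operator from the Hilbert space to the \<open>\<ell>\<^sup>2\<close>-sum of
  countably many copies of it, has norm at most \<open>sqrt B\<close>.
\<close>

definition column_bounded :: "real \<Rightarrow> (nat \<Rightarrow> 'h::complex_hilbert_space bop) \<Rightarrow> bool"
  where "column_bounded B x \<longleftrightarrow>
    0 \<le> B \<and> (\<forall>n \<xi>. (\<Sum>i<n. (norm (blinfun_apply (x i) \<xi>))\<^sup>2) \<le> B * (norm \<xi>)\<^sup>2)"

lemma sum_norm_square_eq_inner:
  assumes "\<And>i. x i \<in> BH"
  shows "(\<Sum>i\<in>I. (norm (blinfun_apply (x i) \<xi>))\<^sup>2)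
    = inner \<xi> (blinfun_apply (\<Sum>i\<in>I. adj (x i) o\<^sub>L x i) \<xi>)"
  using assms by (simp add: blinfun.sum_left inner_sum_right power2_norm_eq_inner inner_adj)

lemma sum_norm_square_le:
  assumes "\<And>i. x i \<in> BH"
  shows "(\<Sum>i\<in>I. (norm (blinfun_apply (x i) \<xi>))\<^sup>2)
    \<le> norm (\<Sum>i\<in>I. adj (x i) o\<^sub>L x i) * (norm \<xi>)\<^sup>2"
proof -
  have "inner \<xi> (blinfun_apply (\<Sum>i\<in>I. adj (x i) o\<^sub>L x i) \<xi>)
      \<le> norm \<xi> * (norm (\<Sum>i\<in>I. adj (x i) o\<^sub>L x i) * norm \<xi>)"
    by (intro order_trans[OF norm_cauchy_schwarz] mult_left_mono norm_blinfun) auto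
  then show ?thesis
    using sum_norm_square_eq_inner[of x, OF assms] by (simp add: power2_eq_square ac_simps)
qed

lemma adj_gram_sum:
  assumes "\<And>i. x i \<in> BH"
  shows "adj (\<Sum>i\<in>I. adj (x i) o\<^sub>L x i) = (\<Sum>i\<in>I. adj (x i) o\<^sub>L x i)"
  using assms by (subst adj_sum) (auto simp: adj_compose adj_BH adj_adj BH_compose)

text \<open>
  The Cauchy-Schwarz inequality for columns: test the sum against vectors and apply the scalar
  inequality to the sequences \<open>norm (x i \<xi>)\<close> and \<open>norm (y i \<eta>)\<close>.
\<close>
lemma norm_sum_adj_compose_le:
  fixes x y :: "'i \<Rightarrow> 'h::complex_hilbert_space bop"
  assumes x: "\<And>i. x i \<in> BH" and "0 \<le> B" "0 \<le> C"
    and B: "\<And>\<xi>. (\<Sum>i\<in>I. (norm (blinfun_apply (x i) \<xi>))\<^sup>2) \<le> B * (norm \<xi>)\<^sup>2"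
    and C: "\<And>\<xi>. (\<Sum>i\<in>I. (norm (blinfun_apply (y i) \<xi>))\<^sup>2) \<le> C * (norm \<xi>)\<^sup>2"
  shows "norm (\<Sum>i\<in>I. adj (x i) o\<^sub>L y i) \<le> sqrt B * sqrt C"
proof (rule norm_blinfun_le_inner)
  fix \<xi> \<eta>
  have L2: "L2_set (\<lambda>i. norm (blinfun_apply (z i) \<zeta>)) I \<le> sqrt D * norm \<zeta>"
    if "(\<Sum>i\<in>I. (norm (blinfun_apply (z i) \<zeta>))\<^sup>2) \<le> D * (norm \<zeta>)\<^sup>2"
    for z :: "'i \<Rightarrow> 'h bop" and \<zeta> D
    using real_sqrt_le_mono[OF that] by (simp add: L2_set_def real_sqrt_mult)
  have "inner \<xi> ((\<Sum>i\<in>I. adj (x i) o\<^sub>L y i) \<eta>) = (\<Sum>i\<in>I. inner (x i \<xi>) (y i \<eta>))"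
    using x by (simp add: blinfun.sum_left inner_sum_right inner_adj)
  also have "\<dots> \<le> (\<Sum>i\<in>I. \<bar>norm (x i \<xi>)\<bar> * \<bar>norm (y i \<eta>)\<bar>)"
    by (intro sum_mono) (simp add: norm_cauchy_schwarz)
  also have "\<dots> \<le> L2_set (\<lambda>i. norm (x i \<xi>)) I * L2_set (\<lambda>i. norm (y i \<eta>)) I"
    by (rule L2_set_mult_ineq)
  also have "\<dots> \<le> (sqrt B * norm \<xi>) * (sqrt C * norm \<eta>)"
    by (intro mult_mono L2 B C L2_set_nonneg mult_nonneg_nonneg) (simp_all add: \<open>0 \<le> B\<close>)
  finally show "inner \<xi> ((\<Sum>i\<in>I. adj (x i) o\<^sub>L y i) \<eta>) \<le> sqrt B * sqrt C * norm \<xi> * norm \<eta>"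
    by (simp add: ac_simps)
qed (simp add: assms)

lemma sum_norm_square_le_limit:
  assumes "\<And>i. x i \<in> BH"
    and "(\<lambda>n. inner \<xi> (blinfun_apply (\<Sum>i<n. adj (x i) o\<^sub>L x i) \<xi>)) \<longlonglongrightarrow> l"
  shows "(\<Sum>i<n. (norm (blinfun_apply (x i) \<xi>))\<^sup>2) \<le> l"
proof (rule incseq_le)
  show "incseq (\<lambda>n. \<Sum>i<n. (norm (blinfun_apply (x i) \<xi>))\<^sup>2)"
    by (intro monoI sum_mono2) auto
  show "(\<lambda>n. \<Sum>i<n. (norm (blinfun_apply (x i) \<xi>))\<^sup>2) \<longlonglongrightarrow> l"
    using assms(2) by (simp add: sum_norm_square_eq_inner[of x, OF assms(1)])
qed

lemma column_bounded_of_summable: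
  assumes x: "\<And>i. x i \<in> BH" and "summable (\<lambda>i. adj (x i) o\<^sub>L x i)"
  shows "column_bounded (norm (\<Sum>i. adj (x i) o\<^sub>L x i)) x"
  unfolding column_bounded_def
proof (intro conjI allI)
  fix n and \<xi> :: 'a
  let ?T = "\<Sum>i. adj (x i) o\<^sub>L x i"
  have "(\<lambda>n. inner \<xi> (blinfun_apply (\<Sum>i<n. adj (x i) o\<^sub>L x i) \<xi>)) \<longlonglongrightarrow> inner \<xi> (blinfun_apply ?T \<xi>)"
    by (intro tendsto_intros summable_LIMSEQ assms(2))
  then have "(\<Sum>i<n. (norm (blinfun_apply (x i) \<xi>))\<^sup>2) \<le> inner \<xi> (blinfun_apply ?T \<xi>)"
    by (rule sum_norm_square_le_limit[of x, OF x])
  also have "\<dots> \<le> norm \<xi> * (norm ?T * norm \<xi>)"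
    by (intro order_trans[OF norm_cauchy_schwarz] mult_left_mono norm_blinfun) auto
  finally show "(\<Sum>i<n. (norm (blinfun_apply (x i) \<xi>))\<^sup>2) \<le> norm ?T * (norm \<xi>)\<^sup>2"
    by (simp add: power2_eq_square ac_simps)
qed simp

text \<open>
  By Cauchy-Schwarz a block of the series is controlled by the same block of \<open>\<Sum> adj (x i) o\<^sub>L x i\<close>;
  for \<open>b\<close> a uniform bound on the partial sums is enough.
\<close>
lemma summable_adj_compose:
  assumes b: "\<And>i. b i \<in> BH" and x: "\<And>i. x i \<in> BH"
    and B: "column_bounded B b" and summable: "summable (\<lambda>i. adj (x i) o\<^sub>L x i)"
  shows "summable (\<lambda>i. adj (b i) o\<^sub>L x i)"
  unfolding summable_Cauchy
proof (intro allI impI)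
  fix e :: real assume e: "0 < e"
  have "0 \<le> B" using B by (simp add: column_bounded_def)
  \<comment> \<open>chosen so that \<open>sqrt B * sqrt d < e\<close>; the summand 1 covers the case \<open>B = 0\<close>\<close>
  define d where "d = (e / (sqrt B + 1))\<^sup>2"
  have "0 < sqrt B + 1" using \<open>0 \<le> B\<close> by (simp add: add_nonneg_pos)
  then have "0 < d" using e by (simp add: d_def)
  then obtain N where N: "\<And>m n. N \<le> m \<Longrightarrow> norm (\<Sum>i=m..<n. adj (x i) o\<^sub>L x i) < d"
    using summable unfolding summable_Cauchy by blast
  have "norm (\<Sum>i=m..<n. adj (b i) o\<^sub>L x i) < e" if "N \<le> m" for m n
  proof -
    have "norm (\<Sum>i=m..<n. adj (b i) o\<^sub>L x i) \<le> sqrt B * sqrt (norm (\<Sum>i=m..<n. adj (x i) o\<^sub>L x i))"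
    proof (rule norm_sum_adj_compose_le[OF b \<open>0 \<le> B\<close>])
      fix \<xi>
      have "(\<Sum>i=m..<n. (norm (b i \<xi>))\<^sup>2) \<le> (\<Sum>i<n. (norm (b i \<xi>))\<^sup>2)"
        by (intro sum_mono2) auto
      also have "\<dots> \<le> B * (norm \<xi>)\<^sup>2" using B by (simp add: column_bounded_def)
      finally show "(\<Sum>i=m..<n. (norm (b i \<xi>))\<^sup>2) \<le> B * (norm \<xi>)\<^sup>2" .
    qed (auto intro: sum_norm_square_le x)
    also have "\<dots> \<le> sqrt B * sqrt d"
      using N[OF that, of n] \<open>0 \<le> B\<close> by (intro mult_left_mono) auto
    also have "\<dots> = sqrt B * (e / (sqrt B + 1))"
      using e \<open>0 < sqrt B + 1\<close> by (simp add: d_def)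
    also have "\<dots> < e" using e \<open>0 < sqrt B + 1\<close> by (simp add: field_simps)
    finally show ?thesis .
  qed
  then show "\<exists>N. \<forall>m\<ge>N. \<forall>n. norm (\<Sum>i=m..<n. adj (b i) o\<^sub>L x i) < e" by blast
qed

lemmas sums_compose_right =
  bounded_linear.sums[OF bounded_bilinear.bounded_linear_right[OF bounded_bilinear_blinfun_compose]]

lemma sum_compose: "(\<Sum>i\<in>I. x i) o\<^sub>L a = (\<Sum>i\<in>I. x i o\<^sub>L a)"
  by (rule blinfun_eqI) (simp add: blinfun.sum_left)

lemma compose_sum: "a o\<^sub>L (\<Sum>i\<in>I. x i) = (\<Sum>i\<in>I. a o\<^sub>L x i)"
  by (rule blinfun_eqI) (simp add: blinfun.sum_left blinfun.sum_right)

lemma blinfun_compose_add_right: "T o\<^sub>L (a + b) = (T o\<^sub>L a) + (T o\<^sub>L b)"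
  by (rule blinfun_eqI) (simp add: blinfun.add_left blinfun.add_right)

lemma blinfun_compose_assoc: "(S o\<^sub>L T) o\<^sub>L U = S o\<^sub>L (T o\<^sub>L U)"
  by (rule blinfun_eqI) simp

lemma compose_op_scaleC: "T \<in> BH \<Longrightarrow> T o\<^sub>L op_scaleC c a = op_scaleC c (T o\<^sub>L a)"
  by (rule blinfun_eqI) (simp add: BH_scaleC)

lemma left_strict_sums_iff:
  "left_strict_sums A t T \<longleftrightarrow> (\<forall>a\<in>A. (\<lambda>i. t i o\<^sub>L a) sums (T o\<^sub>L a))"
  by (simp add: left_strict_sums_def sums_def sum_compose)

section \<open>The standard module\<close>

lemma algebra_module_simps [simp]:
  "mcarrier (algebra_module A) = A" "madd (algebra_module A) = (+)"
  "mscale (algebra_module A) = op_scaleC" "mact (algebra_module A) = (o\<^sub>L)"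
  "mip (algebra_module A) a b = adj a o\<^sub>L b"
  by (simp_all add: algebra_module_def)

lemma ell2_simps [simp]:
  "x \<in> mcarrier (ell2 A) \<longleftrightarrow> (\<forall>i. x i \<in> A) \<and> summable (\<lambda>i. adj (x i) o\<^sub>L x i)"
  "madd (ell2 A) x y = (\<lambda>i. x i + y i)" "mscale (ell2 A) c x = (\<lambda>i. op_scaleC c (x i))"
  "mact (ell2 A) x a = (\<lambda>i. x i o\<^sub>L a)" "mip (ell2 A) x y = (\<Sum>i. adj (x i) o\<^sub>L y i)"
  by (simp_all add: ell2_def)

lemma mnorm_algebra_module: "a \<in> BH \<Longrightarrow> mnorm (algebra_module A) a = norm a"
  by (simp add: mnorm_def norm_adj_compose)

lemma mnorm_nonneg: "0 \<le> mnorm M x"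
  by (simp add: mnorm_def)

lemma bounded_module_hom_bound:
  assumes "bounded_module_hom A M N F"
  obtains K where "0 \<le> K" "\<And>x. x \<in> mcarrier M \<Longrightarrow> mnorm N (F x) \<le> K * mnorm M x"
proof -
  obtain K where K: "\<And>x. x \<in> mcarrier M \<Longrightarrow> mnorm N (F x) \<le> K * mnorm M x"
    using assms unfolding bounded_module_hom_def by blast
  have "mnorm N (F x) \<le> \<bar>K\<bar> * mnorm M x" if "x \<in> mcarrier M" for x
    using K[OF that] mult_right_mono[OF abs_ge_self[of K] mnorm_nonneg[of M x]] by linarith
  then show thesis using that[of "\<bar>K\<bar>"] by simp
qed

context nondegenerate_cstar_algebra
begin

lemma left_strict_sums_unique:
  assumes "left_strict_sums A t T" "left_strict_sums A t R"
  shows "T = R"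
proof (rule blinfun_eq_if_compose_eq)
  fix a assume "a \<in> A"
  then have "(\<lambda>i. t i o\<^sub>L a) sums (T o\<^sub>L a)" "(\<lambda>i. t i o\<^sub>L a) sums (R o\<^sub>L a)"
    using assms unfolding left_strict_sums_iff by blast+
  then show "T o\<^sub>L a = R o\<^sub>L a" by (rule sums_unique2)
qed

lemma gram_sum_compose_mem:
  assumes x: "\<And>i. x i \<in> MM A" and a: "a \<in> A"
  shows "(\<Sum>i\<in>I. adj (x i) o\<^sub>L x i) o\<^sub>L a \<in> A"
proof -
  have "adj (x i) o\<^sub>L (x i o\<^sub>L a) \<in> A" for i
    using x[of i] a by (intro adj_RM_compose_mem MM_compose_mem) (auto simp: MM_def)
  then show ?thesis unfolding sum_compose blinfun_compose_assoc by (intro sum_mem)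
qed

lemma adj_tendsto:
  assumes x: "\<And>n. x n \<in> A" and "x \<longlonglongrightarrow> y"
  shows "(\<lambda>n. adj (x n)) \<longlonglongrightarrow> adj y"
proof -
  have y: "y \<in> A" using assms by (rule lim_mem)
  have "norm (adj (x n) - adj y) = norm (x n - y)" for n
  proof -
    have "adj (x n) = adj (x n - y) + adj y"
      using adj_add[of "x n - y" y] x y by (simp add: mem_BH diff_mem)
    then show ?thesis using x y by (simp add: norm_adj mem_BH diff_mem)
  qed
  then show ?thesis using assms(2) by (simp add: tendsto_iff dist_norm)
qed

lemma
  assumes x: "x \<in> mcarrier (ell2 A)" and y: "y \<in> mcarrier (ell2 A)"
  shows ell2_mip_sums: "(\<lambda>i. adj (x i) o\<^sub>L y i) sums mip (ell2 A) x y"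
    and norm_ell2_mip_le: "norm (mip (ell2 A) x y) \<le> mnorm (ell2 A) x * mnorm (ell2 A) y"
proof -
  have x': "\<And>i. x i \<in> BH" "summable (\<lambda>i. adj (x i) o\<^sub>L x i)"
    and y': "\<And>i. y i \<in> BH" "summable (\<lambda>i. adj (y i) o\<^sub>L y i)" using x y by (auto simp: mem_BH)
  note cx = column_bounded_of_summable[of x, OF x'] and cy = column_bounded_of_summable[of y, OF y']
  show sums: "(\<lambda>i. adj (x i) o\<^sub>L y i) sums mip (ell2 A) x y"
    using summable_adj_compose[of x y, OF x'(1) y'(1) cx y'(2)] by (simp add: summable_sums)
  have "norm (\<Sum>i<n. adj (x i) o\<^sub>L y i) \<le> mnorm (ell2 A) x * mnorm (ell2 A) y" for n
    unfolding mnorm_def ell2_simps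
    using cx cy by (intro norm_sum_adj_compose_le x'(1)) (auto simp: column_bounded_def)
  then show "norm (mip (ell2 A) x y) \<le> mnorm (ell2 A) x * mnorm (ell2 A) y"
    using sums unfolding sums_def by (intro Lim_norm_ubound[of sequentially]) auto
qed

lemma adj_ell2_mip:
  assumes x: "x \<in> mcarrier (ell2 A)" and y: "y \<in> mcarrier (ell2 A)"
  shows "adj (mip (ell2 A) x y) = mip (ell2 A) y x"
proof -
  have mem: "adj (x i) o\<^sub>L y i \<in> A" for i using x y by (simp add: adj_mem mult_mem)
  have "(\<lambda>n. adj (\<Sum>i<n. adj (x i) o\<^sub>L y i)) \<longlonglongrightarrow> adj (mip (ell2 A) x y)"
    using ell2_mip_sums[OF x y] mem unfolding sums_def by (intro adj_tendsto sum_mem) auto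
  moreover have "adj (\<Sum>i<n. adj (x i) o\<^sub>L y i) = (\<Sum>i<n. adj (y i) o\<^sub>L x i)" for n
    using x y mem by (simp add: adj_sum mem_BH adj_compose adj_BH adj_adj)
  ultimately have "(\<lambda>i. adj (y i) o\<^sub>L x i) sums adj (mip (ell2 A) x y)" by (simp add: sums_def)
  then show ?thesis using ell2_mip_sums[OF y x] sums_unique2 by blast
qed

lemma norm_component_le:
  assumes x: "x \<in> mcarrier (ell2 A)"
  shows "norm (x i) \<le> mnorm (ell2 A) x"
proof (rule norm_blinfun_bound)
  fix \<xi>
  let ?T = "\<Sum>i. adj (x i) o\<^sub>L x i"
  have "(norm (x i \<xi>))\<^sup>2 \<le> (\<Sum>j<Suc i. (norm (x j \<xi>))\<^sup>2)"
    by (rule member_le_sum) auto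
  also have "\<dots> \<le> norm ?T * (norm \<xi>)\<^sup>2"
  proof -
    have "column_bounded (norm ?T) x"
      using x by (intro column_bounded_of_summable) (auto simp: mem_BH)
    then show ?thesis unfolding column_bounded_def by blast
  qed
  also have "\<dots> = (mnorm (ell2 A) x * norm \<xi>)\<^sup>2" by (simp add: mnorm_def power_mult_distrib)
  finally show "norm (x i \<xi>) \<le> mnorm (ell2 A) x * norm \<xi>"
    by (rule power2_le_imp_le) (simp add: mnorm_nonneg)
qed (rule mnorm_nonneg)

text \<open>
  The multiplier algebra is the algebra of adjointable endomorphisms of \<open>A\<close>; this is what translates
  local adjointability into statements about limits in \<open>MM A\<close>.
\<close>
lemma adjointable_iff_multiplier:
  "adjointable A (algebra_module A) (algebra_module A) F \<longleftrightarrow> (\<exists>R\<in>MM A. \<forall>a\<in>A. F a = R o\<^sub>L a)"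
proof
  assume F: "adjointable A (algebra_module A) (algebra_module A) F"
  then have hom: "bounded_module_hom A (algebra_module A) (algebra_module A) F"
    by (simp add: adjointable_def)
  have mem: "F a \<in> A" if "a \<in> A" for a using hom that by (auto simp: bounded_module_hom_def)
  obtain F' where F': "\<And>b. b \<in> A \<Longrightarrow> F' b \<in> A"
    "\<And>a b. a \<in> A \<Longrightarrow> b \<in> A \<Longrightarrow> adj (F a) o\<^sub>L b = adj a o\<^sub>L F' b"
    using F unfolding adjointable_def by (auto simp: Pi_iff)
  obtain K where "0 \<le> K" "\<And>a. a \<in> A \<Longrightarrow> norm (F a) \<le> K * norm a"
    using bounded_module_hom_bound[OF hom] by (auto simp: mnorm_algebra_module mem_BH mem)
  then show "\<exists>R\<in>MM A. \<forall>a\<in>A. F a = R o\<^sub>L a"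
    using multiplier_of_adjointable[OF mem F'] by metis
next
  assume "\<exists>R\<in>MM A. \<forall>a\<in>A. F a = R o\<^sub>L a"
  then obtain R where R: "R \<in> MM A" and eq: "\<And>a. a \<in> A \<Longrightarrow> F a = R o\<^sub>L a" by blast
  have R_BH: "R \<in> BH" and R_RM: "R \<in> RM A" using R by (auto simp: MM_def LM_def)
  have mem: "R o\<^sub>L a \<in> A" if "a \<in> A" for a using R that by (rule MM_compose_mem)
  show "adjointable A (algebra_module A) (algebra_module A) F"
    unfolding adjointable_def bounded_module_hom_def
  proof (intro conjI)
    show "\<exists>K. \<forall>a\<in>mcarrier (algebra_module A). mnorm (algebra_module A) (F a)
        \<le> K * mnorm (algebra_module A) a"
      using norm_blinfun_compose[of R]
      by (intro exI[of _ "norm R"]) (auto simp: eq mnorm_algebra_module mem_BH mem)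
    show "\<exists>F'\<in>mcarrier (algebra_module A) \<rightarrow> mcarrier (algebra_module A).
        \<forall>a\<in>mcarrier (algebra_module A). \<forall>b\<in>mcarrier (algebra_module A).
          mip (algebra_module A) (F a) b = mip (algebra_module A) a (F' b)"
      by (intro bexI[of _ "\<lambda>b. adj R o\<^sub>L b"])
        (auto simp: eq adj_compose R_BH mem_BH blinfun_compose_assoc adj_RM_compose_mem R_RM)
    show "F \<in> mcarrier (algebra_module A) \<rightarrow> mcarrier (algebra_module A)"
      by (simp add: eq mem)
    show "\<forall>a\<in>mcarrier (algebra_module A). \<forall>b\<in>mcarrier (algebra_module A).
        F (madd (algebra_module A) a b) = madd (algebra_module A) (F a) (F b)"
      by (simp add: eq add_mem blinfun_compose_add_right)
    show "\<forall>c. \<forall>a\<in>mcarrier (algebra_module A).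
        F (mscale (algebra_module A) c a) = mscale (algebra_module A) c (F a)"
      by (simp add: eq scale_mem compose_op_scaleC[OF R_BH])
    show "\<forall>a\<in>mcarrier (algebra_module A). \<forall>b\<in>A.
        F (mact (algebra_module A) a b) = mact (algebra_module A) (F a) b"
      by (simp add: eq mult_mem blinfun_compose_assoc)
  qed
qed

text \<open>
  The form \<open>inner \<xi> (S n \<xi>) = (\<Sum>i<n. (norm (x i \<xi>))\<^sup>2)\<close> increases with \<open>n\<close>, so on the dense span of the
  \<open>a \<xi>\<close>, where it converges, it stays below its limit \<open>inner \<xi> (T \<xi>)\<close>. For fixed \<open>n\<close> the resulting
  inequality is closed in \<open>\<xi>\<close> and thus extends to the whole space.
\<close>
lemma column_bounded_of_weak_limit:
  assumes x: "\<And>i. x i \<in> BH"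
    and lim: "\<And>a b. a \<in> A \<Longrightarrow> b \<in> A \<Longrightarrow>
      (\<lambda>n. adj a o\<^sub>L ((\<Sum>i<n. adj (x i) o\<^sub>L x i) o\<^sub>L b)) \<longlonglongrightarrow> (adj a o\<^sub>L (T o\<^sub>L b))"
  shows "column_bounded (norm T) x"
  unfolding column_bounded_def
proof (intro conjI allI)
  fix n \<xi>
  define S where "S n = (\<Sum>i<n. adj (x i) o\<^sub>L x i)" for n
  have range_range: "(\<lambda>n. inner (blinfun_apply a \<zeta>) (S n (blinfun_apply b \<eta>))) \<longlonglongrightarrow> inner (a \<zeta>) (T (b \<eta>))"
    if "a \<in> A" "b \<in> A" for a b \<zeta> \<eta>
  proof -
    have "(\<lambda>n. inner \<zeta> ((adj a o\<^sub>L (S n o\<^sub>L b)) \<eta>)) \<longlonglongrightarrow> inner \<zeta> ((adj a o\<^sub>L (T o\<^sub>L b)) \<eta>)"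
      using lim[OF that] unfolding S_def by (intro tendsto_inner tendsto_const blinfun.tendsto)
    then show ?thesis using that by (simp add: inner_adj mem_BH)
  qed
  have span_range: "(\<lambda>n. inner (blinfun_apply a \<zeta>) (S n \<eta>)) \<longlonglongrightarrow> inner (a \<zeta>) (T \<eta>)"
    if "\<eta> \<in> span {blinfun_apply a \<xi> | a \<xi>. a \<in> A}" "a \<in> A" for a \<zeta> \<eta>
    using that(1)
    by (induction rule: span_range_induct)
       (use that(2) in \<open>auto simp: range_range blinfun.add_right blinfun.scaleR_right
          inner_simps intro: tendsto_intros\<close>)
  have span_span: "(\<lambda>n. inner \<zeta> (S n \<eta>)) \<longlonglongrightarrow> inner \<zeta> (T \<eta>)"
    if "\<zeta> \<in> span {blinfun_apply a \<xi> | a \<xi>. a \<in> A}"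
       "\<eta> \<in> span {blinfun_apply a \<xi> | a \<xi>. a \<in> A}" for \<zeta> \<eta>
    using that(1)
    by (induction rule: span_range_induct)
       (use that(2) in \<open>auto simp: span_range inner_simps intro: tendsto_intros\<close>)
  show "(\<Sum>i<n. (norm (blinfun_apply (x i) \<xi>))\<^sup>2) \<le> norm T * (norm \<xi>)\<^sup>2"
  proof (rule dense_induct[where P = "\<lambda>\<xi>. (\<Sum>i<n. (norm (blinfun_apply (x i) \<xi>))\<^sup>2) \<le> norm T * (norm \<xi>)\<^sup>2"])
    show "closed {\<xi>. (\<Sum>i<n. (norm (blinfun_apply (x i) \<xi>))\<^sup>2) \<le> norm T * (norm \<xi>)\<^sup>2}"
      by (intro closed_Collect_le continuous_intros)
    fix \<eta> assume \<eta>: "\<eta> \<in> span {blinfun_apply a \<xi> | a \<xi>. a \<in> A}"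
    have "(\<Sum>i<n. (norm (blinfun_apply (x i) \<eta>))\<^sup>2) \<le> inner \<eta> (T \<eta>)"
      by (rule sum_norm_square_le_limit[of x, OF x]) (rule span_span[OF \<eta> \<eta>, unfolded S_def])
    also have "\<dots> \<le> norm \<eta> * (norm T * norm \<eta>)"
      by (intro order_trans[OF norm_cauchy_schwarz] mult_left_mono norm_blinfun) auto
    finally show "(\<Sum>i<n. (norm (blinfun_apply (x i) \<eta>))\<^sup>2) \<le> norm T * (norm \<eta>)\<^sup>2"
      by (simp add: power2_eq_square ac_simps)
  qed
qed simp

text \<open>
  The adjoint sends \<open>x\<close> to \<open>\<Sum> adj (\<beta> i) o\<^sub>L x i\<close>. This series converges by \<open>summable_adj_compose\<close>,
  as strict convergence bounds the column \<open>\<beta>\<close>.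
\<close>
lemma adjointable_column:
  assumes \<beta>: "\<And>i. \<beta> i \<in> MM A"
    and T: "left_strict_sums A (\<lambda>i. adj (\<beta> i) o\<^sub>L \<beta> i) T"
  shows "adjointable A (algebra_module A) (ell2 A) (\<lambda>a i. \<beta> i o\<^sub>L a)"
proof -
  have \<beta>_BH: "\<beta> i \<in> BH" and \<beta>_RM: "\<beta> i \<in> RM A" for i using \<beta> by (auto simp: MM_def LM_def)
  have mem: "\<beta> i o\<^sub>L a \<in> A" if "a \<in> A" for a i using \<beta> that by (rule MM_compose_mem)
  have adj_col: "adj (\<beta> i o\<^sub>L a) o\<^sub>L y = adj a o\<^sub>L (adj (\<beta> i) o\<^sub>L y)" if "a \<in> A" for a i y
    using that by (simp add: adj_compose \<beta>_BH mem_BH blinfun_compose_assoc)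
  have sums: "(\<lambda>i. adj (\<beta> i o\<^sub>L a) o\<^sub>L (\<beta> i o\<^sub>L b)) sums (adj a o\<^sub>L (T o\<^sub>L b))"
    if "a \<in> A" "b \<in> A" for a b
  proof -
    have "(\<lambda>i. (adj (\<beta> i) o\<^sub>L \<beta> i) o\<^sub>L b) sums (T o\<^sub>L b)"
      using T that(2) by (simp add: left_strict_sums_iff)
    then have "(\<lambda>i. adj a o\<^sub>L ((adj (\<beta> i) o\<^sub>L \<beta> i) o\<^sub>L b)) sums (adj a o\<^sub>L (T o\<^sub>L b))"
      by (rule sums_compose_right)
    then show ?thesis using that(1) by (simp add: adj_col blinfun_compose_assoc)
  qed
  have carrier: "(\<lambda>i. \<beta> i o\<^sub>L a) \<in> mcarrier (ell2 A)" if "a \<in> A" for a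
    using that mem sums[OF that that] by (auto intro: sums_summable)
  have bounded: "column_bounded (norm T) \<beta>"
  proof (rule column_bounded_of_weak_limit[OF \<beta>_BH])
    fix a b assume "a \<in> A" "b \<in> A"
    then show "(\<lambda>n. adj a o\<^sub>L ((\<Sum>i<n. adj (\<beta> i) o\<^sub>L \<beta> i) o\<^sub>L b)) \<longlonglongrightarrow> (adj a o\<^sub>L (T o\<^sub>L b))"
      using sums[of a b] by (simp add: sums_def sum_compose compose_sum adj_col blinfun_compose_assoc)
  qed
  have summable: "summable (\<lambda>i. adj (\<beta> i) o\<^sub>L x i)" if "x \<in> mcarrier (ell2 A)" for x
    using that by (intro summable_adj_compose[OF \<beta>_BH _ bounded]) (auto simp: mem_BH)
  show ?thesis
    unfolding adjointable_def bounded_module_hom_def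
  proof (intro conjI)
    show "\<exists>K. \<forall>a\<in>mcarrier (algebra_module A). mnorm (ell2 A) (\<lambda>i. \<beta> i o\<^sub>L a)
        \<le> K * mnorm (algebra_module A) a"
    proof (intro exI[of _ "sqrt (norm T)"] ballI)
      fix a assume "a \<in> mcarrier (algebra_module A)"
      then have a: "a \<in> A" by simp
      have "norm (adj a o\<^sub>L (T o\<^sub>L a)) \<le> norm a * (norm T * norm a)"
        using norm_blinfun_compose[of "adj a" "T o\<^sub>L a"] mult_left_mono[OF norm_blinfun_compose[of T a], of "norm a"] a
        by (simp add: norm_adj mem_BH)
      then have "norm (adj a o\<^sub>L (T o\<^sub>L a)) \<le> norm T * (norm a)\<^sup>2"
        by (simp add: power2_eq_square ac_simps)
      then have "sqrt (norm (adj a o\<^sub>L (T o\<^sub>L a))) \<le> sqrt (norm T) * norm a"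
        using real_sqrt_le_mono by (fastforce simp: real_sqrt_mult)
      then show "mnorm (ell2 A) (\<lambda>i. \<beta> i o\<^sub>L a) \<le> sqrt (norm T) * mnorm (algebra_module A) a"
        using sums_unique[OF sums[OF a a]] a unfolding mnorm_algebra_module[OF mem_BH[OF a]]
        by (simp add: mnorm_def)
    qed
    show "\<exists>F'\<in>mcarrier (ell2 A) \<rightarrow> mcarrier (algebra_module A).
        \<forall>a\<in>mcarrier (algebra_module A). \<forall>x\<in>mcarrier (ell2 A).
          mip (ell2 A) (\<lambda>i. \<beta> i o\<^sub>L a) x = mip (algebra_module A) a (F' x)"
    proof (intro bexI[of _ "\<lambda>x. \<Sum>i. adj (\<beta> i) o\<^sub>L x i"] ballI funcsetI)
      fix a x assume a: "a \<in> mcarrier (algebra_module A)" and x: "x \<in> mcarrier (ell2 A)"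
      have "(\<lambda>i. adj a o\<^sub>L (adj (\<beta> i) o\<^sub>L x i)) sums (adj a o\<^sub>L (\<Sum>i. adj (\<beta> i) o\<^sub>L x i))"
        by (intro sums_compose_right summable_sums summable x)
      then show "mip (ell2 A) (\<lambda>i. \<beta> i o\<^sub>L a) x = mip (algebra_module A) a (\<Sum>i. adj (\<beta> i) o\<^sub>L x i)"
        using a by (simp add: adj_col sums_unique[symmetric])
    next
      fix x assume x: "x \<in> mcarrier (ell2 A)"
      then show "(\<Sum>i. adj (\<beta> i) o\<^sub>L x i) \<in> mcarrier (algebra_module A)"
        using suminf_mem[OF _ summable[OF x]] by (simp add: adj_RM_compose_mem \<beta>_RM)
    qed
    show "(\<lambda>a i. \<beta> i o\<^sub>L a) \<in> mcarrier (algebra_module A) \<rightarrow> mcarrier (ell2 A)"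
      using carrier by auto
    show "\<forall>a\<in>mcarrier (algebra_module A). \<forall>b\<in>mcarrier (algebra_module A).
        (\<lambda>i. \<beta> i o\<^sub>L madd (algebra_module A) a b)
          = madd (ell2 A) (\<lambda>i. \<beta> i o\<^sub>L a) (\<lambda>i. \<beta> i o\<^sub>L b)"
      by (simp add: blinfun_compose_add_right)
    show "\<forall>c. \<forall>a\<in>mcarrier (algebra_module A).
        (\<lambda>i. \<beta> i o\<^sub>L mscale (algebra_module A) c a) = mscale (ell2 A) c (\<lambda>i. \<beta> i o\<^sub>L a)"
      by (simp add: compose_op_scaleC[OF \<beta>_BH])
    show "\<forall>a\<in>mcarrier (algebra_module A). \<forall>b\<in>A.
        (\<lambda>i. \<beta> i o\<^sub>L mact (algebra_module A) a b) = mact (ell2 A) (\<lambda>i. \<beta> i o\<^sub>L a) b"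
      by (simp add: blinfun_compose_assoc)
  qed
qed

lemma single_mem_ell2: "a \<in> A \<Longrightarrow> (\<lambda>j. if j = i then a else 0) \<in> mcarrier (ell2 A)"
  by (auto simp: zero_mem adj_0 split: if_splits intro!: summable_finite[of "{i}"])

text \<open>
  The converse of \<open>adjointable_column\<close>. Both the coordinates of \<open>\<gamma>\<close> and the composition \<open>\<gamma>' \<circ> \<gamma>\<close> of \<open>\<gamma>\<close>
  with its adjoint are adjointable maps of \<open>A\<close>, hence multipliers \<open>\<beta> i\<close> and \<open>T\<close>. The relation between
  \<open>\<gamma>\<close> and its adjoint says that \<open>\<Sum> adj (\<beta> i) o\<^sub>L \<beta> i\<close> converges to \<open>T\<close> when multiplied from both
  sides by elements of \<open>A\<close>. This bounds the column, which upgrades the convergence to left strict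
  convergence; taking adjoints gives right strict convergence because \<open>T\<close> is self-adjoint.
\<close>
lemma column_of_adjointable:
  assumes "adjointable A (algebra_module A) (ell2 A) \<gamma>"
  obtains \<beta> where "\<beta> \<in> ell2_multipliers A" "\<And>a. a \<in> A \<Longrightarrow> \<gamma> a = (\<lambda>i. \<beta> i o\<^sub>L a)"
proof -
  have hom: "bounded_module_hom A (algebra_module A) (ell2 A) \<gamma>"
    using assms by (simp add: adjointable_def)
  have mem: "\<gamma> a \<in> mcarrier (ell2 A)" if "a \<in> A" for a
    using hom that unfolding bounded_module_hom_def Pi_iff algebra_module_simps by blast
  then have mem_i: "\<gamma> a i \<in> A" if "a \<in> A" for a i using that by auto
  obtain \<gamma>' where \<gamma>'_mem: "\<And>x. x \<in> mcarrier (ell2 A) \<Longrightarrow> \<gamma>' x \<in> A"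
    and \<gamma>': "\<And>a x. a \<in> A \<Longrightarrow> x \<in> mcarrier (ell2 A) \<Longrightarrow> mip (ell2 A) (\<gamma> a) x = adj a o\<^sub>L \<gamma>' x"
    using assms unfolding adjointable_def Pi_iff algebra_module_simps by blast
  obtain K where "0 \<le> K" and K: "\<And>a. a \<in> A \<Longrightarrow> mnorm (ell2 A) (\<gamma> a) \<le> K * norm a"
    using bounded_module_hom_bound[OF hom] by (auto simp: mnorm_algebra_module mem_BH)
  have "\<exists>R\<in>MM A. \<forall>a\<in>A. \<gamma> a i = R o\<^sub>L a" for i
  proof -
    have adj_i: "adj (\<gamma> a i) o\<^sub>L b = adj a o\<^sub>L \<gamma>' (\<lambda>j. if j = i then b else 0)"
      if a: "a \<in> A" and b: "b \<in> A" for a b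
    proof -
      have "(\<lambda>j. adj (\<gamma> a j) o\<^sub>L (if j = i then b else 0)) = (\<lambda>j. if j = i then adj (\<gamma> a j) o\<^sub>L b else 0)"
        by auto
      then have "(\<lambda>j. adj (\<gamma> a j) o\<^sub>L (if j = i then b else 0)) sums (adj (\<gamma> a i) o\<^sub>L b)"
        using sums_single[of i "\<lambda>j. adj (\<gamma> a j) o\<^sub>L b"] by simp
      then show ?thesis
        using \<gamma>'[OF a single_mem_ell2[OF b, of i]] by (simp add: sums_unique[symmetric])
    qed
    have bound_i: "norm (\<gamma> a i) \<le> K * norm a" if "a \<in> A" for a
      using norm_component_le[OF mem[OF that]] K[OF that] order_trans by blast
    have \<gamma>'_single: "\<gamma>' (\<lambda>j. if j = i then b else 0) \<in> A" if "b \<in> A" for b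
      using that by (intro \<gamma>'_mem single_mem_ell2)
    show ?thesis
      by (rule multiplier_of_adjointable[of "\<lambda>a. \<gamma> a i", OF mem_i \<gamma>'_single adj_i bound_i \<open>0 \<le> K\<close>]) auto
  qed
  then obtain \<beta> where \<beta>: "\<And>i. \<beta> i \<in> MM A" and \<gamma>_eq: "\<And>i a. a \<in> A \<Longrightarrow> \<gamma> a i = \<beta> i o\<^sub>L a" by metis
  have \<beta>_BH: "\<beta> i \<in> BH" for i using \<beta> by (rule MM_BH)
  have sym: "adj (\<gamma>' (\<gamma> a)) o\<^sub>L b = adj a o\<^sub>L \<gamma>' (\<gamma> b)" if a: "a \<in> A" and b: "b \<in> A" for a b
  proof -
    have "adj (\<gamma>' (\<gamma> a)) o\<^sub>L b = adj (adj b o\<^sub>L \<gamma>' (\<gamma> a))"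
      using a b mem \<gamma>'_mem by (simp add: adj_compose adj_BH adj_adj mem_BH del: ell2_simps)
    also have "\<dots> = mip (ell2 A) (\<gamma> a) (\<gamma> b)"
      using \<gamma>'[OF b mem[OF a]] adj_ell2_mip[OF mem[OF b] mem[OF a]] by simp
    finally show ?thesis using \<gamma>'[OF a mem[OF b]] by simp
  qed
  have "norm (\<gamma>' (\<gamma> a)) \<le> K\<^sup>2 * norm a" if a: "a \<in> A" for a
  proof -
    define d where "d = \<gamma>' (\<gamma> a)"
    have d: "d \<in> A" unfolding d_def using a mem \<gamma>'_mem by blast
    have "norm d * norm d = norm (mip (ell2 A) (\<gamma> d) (\<gamma> a))"
      using \<gamma>'[OF d mem[OF a]] norm_adj_compose[OF mem_BH[OF d]]
      by (simp add: d_def power2_eq_square del: ell2_simps)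
    also have "\<dots> \<le> mnorm (ell2 A) (\<gamma> d) * mnorm (ell2 A) (\<gamma> a)"
      using a d by (intro norm_ell2_mip_le mem)
    also have "\<dots> \<le> (K * norm d) * (K * norm a)"
      using a d \<open>0 \<le> K\<close> by (intro mult_mono K mnorm_nonneg mult_nonneg_nonneg) auto
    finally have "norm d * norm d \<le> (K\<^sup>2 * norm a) * norm d"
      by (simp add: power2_eq_square ac_simps)
    then have "norm d \<le> K\<^sup>2 * norm a"
      by (rule le_if_square_le) simp_all
    then show ?thesis by (simp add: d_def)
  qed
  then obtain T where T: "T \<in> MM A" and T_eq: "\<And>a. a \<in> A \<Longrightarrow> \<gamma>' (\<gamma> a) = T o\<^sub>L a"
    using multiplier_of_adjointable[of "\<lambda>a. \<gamma>' (\<gamma> a)" "\<lambda>a. \<gamma>' (\<gamma> a)" "K\<^sup>2"] mem \<gamma>'_mem sym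
    by (metis zero_le_power2)
  have T_BH: "T \<in> BH" using T by (rule MM_BH)
  have adj_T: "adj T = T"
  proof (rule blinfun_eq_if_compose_eq)
    fix b assume b: "b \<in> A"
    show "adj T o\<^sub>L b = T o\<^sub>L b"
    proof (rule blinfun_eq_if_adj_compose_eq)
      fix a assume a: "a \<in> A"
      show "adj a o\<^sub>L (adj T o\<^sub>L b) = adj a o\<^sub>L (T o\<^sub>L b)"
        using sym[OF a b] a b by (simp add: T_eq adj_compose T_BH mem_BH blinfun_compose_assoc)
    qed
  qed
  have weak: "(\<lambda>i. adj a o\<^sub>L ((adj (\<beta> i) o\<^sub>L \<beta> i) o\<^sub>L b)) sums (adj a o\<^sub>L (T o\<^sub>L b))"
    if a: "a \<in> A" and b: "b \<in> A" for a b
    using ell2_mip_sums[OF mem[OF a] mem[OF b]] \<gamma>'[OF a mem[OF b]] a b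
    by (simp add: T_eq \<gamma>_eq adj_compose \<beta>_BH mem_BH blinfun_compose_assoc del: ell2_simps)
  have bounded: "column_bounded (norm T) \<beta>"
    using weak by (intro column_bounded_of_weak_limit[OF \<beta>_BH]) (simp add: sums_def sum_compose compose_sum)
  have left: "(\<lambda>i. (adj (\<beta> i) o\<^sub>L \<beta> i) o\<^sub>L b) sums (T o\<^sub>L b)" if b: "b \<in> A" for b
  proof -
    have "summable (\<lambda>i. adj (\<beta> i) o\<^sub>L \<gamma> b i)"
      using mem[OF b] by (intro summable_adj_compose[OF \<beta>_BH _ bounded]) (auto simp: mem_BH)
    then obtain l where l: "(\<lambda>i. (adj (\<beta> i) o\<^sub>L \<beta> i) o\<^sub>L b) sums l"
      using b by (auto simp: \<gamma>_eq blinfun_compose_assoc summable_def)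
    have "l = T o\<^sub>L b"
    proof (rule blinfun_eq_if_adj_compose_eq)
      fix a assume "a \<in> A"
      then show "adj a o\<^sub>L l = adj a o\<^sub>L (T o\<^sub>L b)"
        using sums_compose_right[OF l, of "adj a"] weak[OF _ b] sums_unique2 by blast
    qed
    then show ?thesis using l by simp
  qed
  have right: "(\<lambda>n. a o\<^sub>L (\<Sum>i<n. adj (\<beta> i) o\<^sub>L \<beta> i)) \<longlonglongrightarrow> (a o\<^sub>L T)" if a: "a \<in> A" for a
  proof -
    define S where "S n = (\<Sum>i<n. adj (\<beta> i) o\<^sub>L \<beta> i)" for n
    have S_BH: "S n \<in> BH" for n unfolding S_def by (intro BH_sum BH_compose adj_BH \<beta>_BH)
    have S_adj: "adj (S n) = S n" for n
      unfolding S_def by (rule adj_gram_sum) (rule \<beta>_BH)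
    have "S n o\<^sub>L adj a \<in> A" for n
      unfolding S_def by (intro gram_sum_compose_mem \<beta> adj_mem a)
    moreover have "(\<lambda>n. S n o\<^sub>L adj a) \<longlonglongrightarrow> (T o\<^sub>L adj a)"
      using left[OF adj_mem[OF a]] by (simp add: sums_def S_def sum_compose)
    ultimately have "(\<lambda>n. adj (S n o\<^sub>L adj a)) \<longlonglongrightarrow> (adj (T o\<^sub>L adj a))" by (rule adj_tendsto)
    then show ?thesis
      using a by (simp add: adj_compose S_BH T_BH adj_BH adj_adj mem_BH S_adj adj_T S_def[symmetric])
  qed
  have "\<beta> \<in> ell2_multipliers A"
    using \<beta> T left right by (auto simp: ell2_multipliers_def left_strict_sums_iff right_strict_sums_def)
  moreover have "\<gamma> a = (\<lambda>i. \<beta> i o\<^sub>L a)" if "a \<in> A" for a using \<gamma>_eq[OF that] by blast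
  ultimately show thesis using that by blast
qed

end

section \<open>Locally adjointable functionals\<close>

theorem lemma10:
  fixes A :: "('h::complex_hilbert_space \<Rightarrow>\<^sub>L 'h) set"
    and \<Gamma> :: "(nat \<Rightarrow> ('h \<Rightarrow>\<^sub>L 'h)) \<Rightarrow> ('h \<Rightarrow>\<^sub>L 'h)"
    and G :: "nat \<Rightarrow> ('h \<Rightarrow>\<^sub>L 'h)"
  assumes "nondegenerate_cstar_algebra A"
    and "module_functional A (ell2 A) \<Gamma>"
    and "\<And>i. G i \<in> RM A"
    and "\<And>x. x \<in> mcarrier (ell2 A) \<Longrightarrow> (\<lambda>i. adj (G i) o\<^sub>L x i) sums \<Gamma> x"
  shows "locally_adjointable A (ell2 A) (algebra_module A) \<Gamma> \<longleftrightarrow> determines_dual_element A G"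
proof -
  interpret nondegenerate_cstar_algebra A by fact
  have hom: "bounded_module_hom A (ell2 A) (algebra_module A) \<Gamma>"
    using assms(2) by (simp add: module_functional_def)
  have G_BH: "G i \<in> BH" for i using assms(3)[of i] by (simp add: RM_def)
  have MM_subset_LM: "MM A \<subseteq> LM A" by (simp add: MM_def)
  have column_carrier: "(\<lambda>i. \<beta> i o\<^sub>L a) \<in> mcarrier (ell2 A)"
    if "adjointable A (algebra_module A) (ell2 A) (\<lambda>a i. \<beta> i o\<^sub>L a)" "a \<in> A" for \<beta> a
    using that unfolding adjointable_def bounded_module_hom_def Pi_iff algebra_module_simps by blast
  show ?thesis
  proof
    assume local: "locally_adjointable A (ell2 A) (algebra_module A) \<Gamma>"
    \<comment> \<open>the limit exists because \<open>\<Gamma>\<close> converges at \<open>\<beta> a\<close>; adjointability makes it a multiplier\<close>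
    have limit: "\<exists>R\<in>MM A. \<forall>a\<in>A. (\<lambda>i. (adj (G i) o\<^sub>L \<beta> i) o\<^sub>L a) sums (R o\<^sub>L a)"
      if "\<And>i. \<beta> i \<in> MM A" "left_strict_sums A (\<lambda>i. adj (\<beta> i) o\<^sub>L \<beta> i) T" for \<beta> T
    proof -
      note col = adjointable_column[OF that]
      then have "adjointable A (algebra_module A) (algebra_module A) (\<Gamma> \<circ> (\<lambda>a i. \<beta> i o\<^sub>L a))"
        using local by (simp add: locally_adjointable_def)
      then obtain R where "R \<in> MM A" and R: "\<And>a. a \<in> A \<Longrightarrow> \<Gamma> (\<lambda>i. \<beta> i o\<^sub>L a) = R o\<^sub>L a"
        by (auto simp: adjointable_iff_multiplier)
      moreover have "(\<lambda>i. (adj (G i) o\<^sub>L \<beta> i) o\<^sub>L a) sums (R o\<^sub>L a)" if "a \<in> A" for a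
        using assms(4)[OF column_carrier[OF col that]] R[OF that] by (simp add: blinfun_compose_assoc)
      ultimately show ?thesis by blast
    qed
    have G_MM: "G i \<in> MM A" for i
    proof -
      \<comment> \<open>the column of the \<open>i\<close>-th coordinate embedding of \<open>A\<close>\<close>
      define \<beta> :: "nat \<Rightarrow> 'h bop" where "\<beta> j = (if j = i then id_blinfun else 0)" for j
      have id_BH: "id_blinfun \<in> (BH :: 'h bop set)" by (simp add: BH_def)
      have adj_id: "adj (id_blinfun :: 'h bop) = id_blinfun" by (rule adj_eqI) (auto simp: id_BH)
      have id_compose: "id_blinfun o\<^sub>L a = a" "a o\<^sub>L id_blinfun = a" for a :: "'h bop"
        by (auto intro: blinfun_eqI)
      have \<beta>_MM: "\<beta> j \<in> MM A" for j
        by (auto simp: \<beta>_def MM_def LM_def RM_def id_BH BH_0 id_compose zero_mem)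
      have "(adj (\<beta> j) o\<^sub>L \<beta> j) o\<^sub>L a = (if j = i then a else 0)" for j and a :: "'h bop"
        by (simp add: \<beta>_def adj_id adj_0 id_compose)
      then have "left_strict_sums A (\<lambda>j. adj (\<beta> j) o\<^sub>L \<beta> j) id_blinfun"
        using sums_single[of i "\<lambda>_. a" for a :: "'h bop"] by (simp add: left_strict_sums_iff id_compose)
      from limit[OF \<beta>_MM this] obtain R where "R \<in> MM A"
        and R: "\<And>a. a \<in> A \<Longrightarrow> (\<lambda>j. (adj (G j) o\<^sub>L \<beta> j) o\<^sub>L a) sums (R o\<^sub>L a)" by blast
      have "adj (G i) = R"
      proof (rule blinfun_eq_if_compose_eq)
        fix a assume "a \<in> A"
        have "(adj (G j) o\<^sub>L \<beta> j) o\<^sub>L a = (if j = i then adj (G j) o\<^sub>L a else 0)" for j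
          by (simp add: \<beta>_def id_compose)
        then show "adj (G i) o\<^sub>L a = R o\<^sub>L a"
          using R[OF \<open>a \<in> A\<close>] sums_single[of i "\<lambda>j. adj (G j) o\<^sub>L a"] sums_unique2 by simp
      qed
      then have "G i o\<^sub>L a \<in> A" if "a \<in> A" for a
        using adj_RM_compose_mem[of R a] adj_adj[OF G_BH[of i]] \<open>R \<in> MM A\<close> that
        by (simp add: MM_def)
      then show ?thesis using assms(3)[of i] by (simp add: MM_def LM_def RM_def)
    qed
    have "bounded (range (\<lambda>n. \<Sum>i<n. adj (G i) o\<^sub>L G i))"
    proof -
      obtain K where "0 \<le> K" and K: "\<And>x. x \<in> mcarrier (ell2 A) \<Longrightarrow> norm (\<Gamma> x) \<le> K * mnorm (ell2 A) x"
      proof -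
        have "\<Gamma> x \<in> A" if "x \<in> mcarrier (ell2 A)" for x
          using hom that unfolding bounded_module_hom_def Pi_iff algebra_module_simps by blast
        then show thesis
          using bounded_module_hom_bound[OF hom] that by (metis mnorm_algebra_module mem_BH)
      qed
      have "norm (\<Sum>i<n. adj (G i) o\<^sub>L G i) \<le> K\<^sup>2" for n
      proof -
        define S where "S = (\<Sum>i<n. adj (G i) o\<^sub>L G i)"
        have S_BH: "S \<in> BH" unfolding S_def by (intro BH_sum BH_compose adj_BH G_BH)
        have S_adj: "adj S = S"
          unfolding S_def by (rule adj_gram_sum) (rule G_BH)
        have S_mem: "S o\<^sub>L a \<in> A" if "a \<in> A" for a
          unfolding S_def by (intro gram_sum_compose_mem G_MM that)
        have "norm (S o\<^sub>L a) \<le> K\<^sup>2 * norm a" if a: "a \<in> A" for a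
        proof -
          \<comment> \<open>at this \<open>x\<close> the functional takes the value \<open>S o\<^sub>L a\<close>, and \<open>x\<close> has inner square
              \<open>adj a o\<^sub>L (S o\<^sub>L a)\<close>, so boundedness of \<open>\<Gamma>\<close> bounds \<open>S o\<^sub>L a\<close> by itself\<close>
          define x where "x i = (if i < n then G i o\<^sub>L a else 0)" for i
          have x_mem: "x i \<in> A" for i
            using a MM_compose_mem[OF G_MM] by (simp add: x_def zero_mem)
          have "(\<lambda>i. adj (x i) o\<^sub>L x i) sums (\<Sum>i<n. adj (x i) o\<^sub>L x i)"
            by (rule sums_finite) (auto simp: x_def)
          also have "(\<Sum>i<n. adj (x i) o\<^sub>L x i) = adj a o\<^sub>L (S o\<^sub>L a)"
            using a by (simp add: S_def x_def sum_compose compose_sum adj_compose G_BH mem_BH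
                blinfun_compose_assoc)
          finally have xx: "(\<lambda>i. adj (x i) o\<^sub>L x i) sums (adj a o\<^sub>L (S o\<^sub>L a))" .
          then have x: "x \<in> mcarrier (ell2 A)" using x_mem by (auto intro: sums_summable)
          have "(\<lambda>i. adj (G i) o\<^sub>L x i) sums (\<Sum>i<n. adj (G i) o\<^sub>L x i)"
            by (rule sums_finite) (auto simp: x_def)
          also have "(\<Sum>i<n. adj (G i) o\<^sub>L x i) = S o\<^sub>L a"
            by (simp add: S_def x_def sum_compose blinfun_compose_assoc)
          finally have "\<Gamma> x = S o\<^sub>L a" using assms(4)[OF x] sums_unique2 by blast
          then have "(norm (S o\<^sub>L a))\<^sup>2 \<le> (K * mnorm (ell2 A) x)\<^sup>2"
            using K[OF x] by (intro power_mono) auto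
          also have "\<dots> = K\<^sup>2 * norm (adj a o\<^sub>L (S o\<^sub>L a))"
            using sums_unique[OF xx] by (simp add: mnorm_def power_mult_distrib)
          also have "\<dots> \<le> K\<^sup>2 * (norm a * norm (S o\<^sub>L a))"
            using norm_blinfun_compose[of "adj a" "S o\<^sub>L a"] a
            by (intro mult_left_mono) (auto simp: norm_adj mem_BH)
          finally have "norm (S o\<^sub>L a) * norm (S o\<^sub>L a) \<le> (K\<^sup>2 * norm a) * norm (S o\<^sub>L a)"
            by (simp add: power2_eq_square ac_simps)
          then show ?thesis
            by (rule le_if_square_le) simp_all
        qed
        moreover have "adj (S o\<^sub>L a) o\<^sub>L b = adj a o\<^sub>L (S o\<^sub>L b)" if "a \<in> A" for a b
          using that by (simp add: adj_compose S_BH S_adj mem_BH blinfun_compose_assoc)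
        ultimately obtain R where "norm R \<le> K\<^sup>2" "\<And>a. a \<in> A \<Longrightarrow> S o\<^sub>L a = R o\<^sub>L a"
          using multiplier_of_adjointable[of "(o\<^sub>L) S" "(o\<^sub>L) S" "K\<^sup>2"] S_mem
          by (metis zero_le_power2)
        then show ?thesis using blinfun_eq_if_compose_eq S_def by metis
      qed
      then show ?thesis by (auto simp: bounded_iff)
    qed
    moreover have limit_MM: "\<exists>R\<in>MM A. left_strict_sums A (\<lambda>i. adj (G i) o\<^sub>L \<beta> i) R"
      if "\<beta> \<in> ell2_multipliers A" for \<beta>
      using that limit by (auto simp: ell2_multipliers_def left_strict_sums_iff)
    moreover have "T \<in> MM A" if "\<beta> \<in> ell2_multipliers A"
      "left_strict_sums A (\<lambda>i. adj (G i) o\<^sub>L \<beta> i) T" for \<beta> T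
    proof -
      obtain R where "R \<in> MM A" "left_strict_sums A (\<lambda>i. adj (G i) o\<^sub>L \<beta> i) R"
        using limit_MM \<open>\<beta> \<in> ell2_multipliers A\<close> by blast
      then show ?thesis using left_strict_sums_unique[OF that(2)] by simp
    qed
    ultimately show "determines_dual_element A G"
      unfolding determines_dual_element_def
    proof (intro conjI allI ballI impI)
      fix \<beta> assume "\<beta> \<in> ell2_multipliers A"
      then show "\<exists>T\<in>LM A. left_strict_sums A (\<lambda>i. adj (G i) o\<^sub>L \<beta> i) T"
        using limit_MM[of \<beta>] MM_subset_LM by blast
    qed (simp_all add: G_MM)
  next
    assume dual: "determines_dual_element A G"
    show "locally_adjointable A (ell2 A) (algebra_module A) \<Gamma>"
      unfolding locally_adjointable_def
    proof (intro conjI allI impI hom)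
      fix \<gamma> assume \<gamma>: "adjointable A (algebra_module A) (ell2 A) \<gamma>"
      obtain \<beta> where \<beta>: "\<beta> \<in> ell2_multipliers A" and \<gamma>_eq: "\<And>a. a \<in> A \<Longrightarrow> \<gamma> a = (\<lambda>i. \<beta> i o\<^sub>L a)"
        using column_of_adjointable[OF \<gamma>] by metis
      have mem: "\<gamma> a \<in> mcarrier (ell2 A)" if "a \<in> A" for a
        using \<gamma> that unfolding adjointable_def bounded_module_hom_def Pi_iff algebra_module_simps by blast
      obtain R where "R \<in> MM A" and R: "left_strict_sums A (\<lambda>i. adj (G i) o\<^sub>L \<beta> i) R"
        using dual \<beta> unfolding determines_dual_element_def by blast
      have "\<Gamma> (\<gamma> a) = R o\<^sub>L a" if "a \<in> A" for a
      proof (rule sums_unique2[OF assms(4)[OF mem[OF that]]])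
        show "(\<lambda>i. adj (G i) o\<^sub>L \<gamma> a i) sums (R o\<^sub>L a)"
          using R that by (simp add: left_strict_sums_iff \<gamma>_eq blinfun_compose_assoc)
      qed
      then show "adjointable A (algebra_module A) (algebra_module A) (\<Gamma> \<circ> \<gamma>)"
        using \<open>R \<in> MM A\<close> by (auto simp: adjointable_iff_multiplier)
    qed
  qed
qed

end
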